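(* Let $L$ be a minimal $Q$-graded subalgebra of a finite-dimensional semisimple Lie algebra $\mathbb{L}$ over $\mathbb{F}$ with $\dim L=2\dim[L,L]$, let $S=\mathbb{F}[t,t^{-1}]$, let $\tilde L=L\otimes S\oplus\mathbb{F}K$ be the affinization of $L$, and let $h_1,\dots,h_l$ be a basis of the maximal torus $H\subseteq L$. For $1\le i\le l$ and $j\in\mathbb{Z}$ let $D_{ij}:\tilde L\to\tilde L$ be the linear map determined by $$D_{ij}([L,L]\otimes S)=0,\quad D_{ij}(K)=0,\quad D_{ij}(h_m\otimes t^n)=\delta_{im}\delta_{jn}K\quad(1\le m\le l,\ n\in\mathbb{Z}).$$ Then each $D_{ij}$ is an almost inner derivation of $\tilde L$, and the quotient vector space $AID(\tilde L)/Inn(\tilde L)$ consists of the elements of the form $$\sum_{1\le i\le l,\ j\in\mathbb{Z}}a_{ij}D_{ij}+Inn(\tilde L),\qquad a_{ij}\in\mathbb{F},$$ where the (possibly infinite) sum is a well-defined linear map of $\tilde L$. Moreover, the infinite subset $\{D_{ij}+Inn(\tilde L):1\le i\le l,\ j\in\mathbb{Z}\}$ of $AID(\tilde L)/Inn(\tilde L)$ is linearly independent.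
   Context: $\mathbb{F}$ is an algebraically closed field of characteristic $0$; $\mathbb{L}$ is a finite-dimensional semisimple Lie algebra over $\mathbb{F}$; $H$ is a fixed maximal torus, $\Phi\subset H^*$ the corresponding root system, and $\mathbb{L}=H\oplus\bigoplus_{\alpha\in\Phi}L_\alpha$ the root space decomposition. Put $Q=\mathbb{Z}\Phi$. Definition. A subalgebra $L$ of $\mathbb{L}$ containing $H$ has the form $L=H\oplus\bigoplus_{\alpha\in\Psi}L_\alpha$ with $\Psi\subseteq\Phi$. It is called a $Q$-graded subalgebra if $Q=\mathrm{span}_{\mathbb{Z}}\Psi$. A $Q$-graded subalgebra $L$ is called minimal if there is no $Q$-graded subalgebra $L_1$ of $\mathbb{L}$ with $L_1\subsetneq L$. The affinization of $L$ is the Lie algebra $\tilde L=L\otimes S\oplus\mathbb{F}K$, where $K$ is central and $$[x\otimes t^m,y\otimes t^n]=[x,y]\otimes t^{m+n}+m(x,y)\delta_{m+n,0}K\qquad(x,y\in L,\ m,n\in\mathbb{Z}),$$ with $(\cdot,\cdot)$ the restriction to $L$ of the Killing form of $\mathbb{L}$. A derivation $D$ of a Lie algebra $M$ is almost inner if $D(x)\in[x,M]=\{[x,y]:y\in M\}$ for all $x\in M$. $AID(M)$ is the space of almost inner derivations of $M$ and $Inn(M)$ the space of inner derivations. An infinite sum $\sum a_{ij}D_{ij}$ (arbitrary scalars $a_{ij}$) is understood pointwise: only finitely many terms are nonzero on any given element of $\tilde L$.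
   Formalization: The maps D_ij are claimed almost inner, the sums describing AID/Inn run, and the infinite subset is taken, only over j ≠ 0, since D_i0(h_i⊗1)=K is never in [h_i⊗1, L~]; infinitude is stated for l ≥ 1. *)

theory Defs
  imports
    "HOL-Computational_Algebra.Polynomial"
    "HOL-Library.Poly_Mapping"
    "HOL-Library.Product_Plus"
    "HOL-Library.Function_Algebras"
    "HOL-Library.Set_Algebras"
begin

section \<open>Lie algebras\<close>

locale lie_algebra = vector_space scale
  for scale :: "'k::field \<Rightarrow> 'a::ab_group_add \<Rightarrow> 'a" +
  fixes bracket :: "'a \<Rightarrow> 'a \<Rightarrow> 'a"
  assumes bracket_add_left: "bracket (x + y) z = bracket x z + bracket y z"
    and bracket_add_right: "bracket x (y + z) = bracket x y + bracket x z"
    and bracket_scale_left: "bracket (scale c x) y = scale c (bracket x y)"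
    and bracket_scale_right: "bracket x (scale c y) = scale c (bracket x y)"
    and bracket_self: "bracket x x = 0"
    and jacobi: "bracket x (bracket y z) + bracket y (bracket z x) + bracket z (bracket x y) = 0"

text \<open>
  The remaining notions take the scalar multiplication \<open>s\<close> and the bracket \<open>br\<close> as explicit
  arguments, because they are used both for the ambient algebra and for affinizations.
  The ambient algebra is the whole type; its subalgebras are sets.
\<close>

definition finite_dimensional :: "('k::field \<Rightarrow> 'a::ab_group_add \<Rightarrow> 'a) \<Rightarrow> bool" where
  "finite_dimensional s \<longleftrightarrow> (\<exists>B. finite B \<and> module.span s B = UNIV)"

definition lie_product ::
    "('k::field \<Rightarrow> 'a::ab_group_add \<Rightarrow> 'a) \<Rightarrow> ('a \<Rightarrow> 'a \<Rightarrow> 'a) \<Rightarrow> 'a set \<Rightarrow> 'a set \<Rightarrow> 'a set" where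
  "lie_product s br A B = module.span s {br x y | x y. x \<in> A \<and> y \<in> B}"

definition lie_subalgebra ::
    "('k::field \<Rightarrow> 'a::ab_group_add \<Rightarrow> 'a) \<Rightarrow> ('a \<Rightarrow> 'a \<Rightarrow> 'a) \<Rightarrow> 'a set \<Rightarrow> bool" where
  "lie_subalgebra s br A \<longleftrightarrow> module.subspace s A \<and> (\<forall>x\<in>A. \<forall>y\<in>A. br x y \<in> A)"

definition lie_ideal ::
    "('k::field \<Rightarrow> 'a::ab_group_add \<Rightarrow> 'a) \<Rightarrow> ('a \<Rightarrow> 'a \<Rightarrow> 'a) \<Rightarrow> 'a set \<Rightarrow> bool" where
  "lie_ideal s br I \<longleftrightarrow> module.subspace s I \<and> (\<forall>x. \<forall>y\<in>I. br x y \<in> I)"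

primrec derived_series ::
    "('k::field \<Rightarrow> 'a::ab_group_add \<Rightarrow> 'a) \<Rightarrow> ('a \<Rightarrow> 'a \<Rightarrow> 'a) \<Rightarrow> 'a set \<Rightarrow> nat \<Rightarrow> 'a set" where
  "derived_series s br A 0 = A"
| "derived_series s br A (Suc n) =
     lie_product s br (derived_series s br A n) (derived_series s br A n)"

definition solvable ::
    "('k::field \<Rightarrow> 'a::ab_group_add \<Rightarrow> 'a) \<Rightarrow> ('a \<Rightarrow> 'a \<Rightarrow> 'a) \<Rightarrow> 'a set \<Rightarrow> bool" where
  "solvable s br A \<longleftrightarrow> (\<exists>n. derived_series s br A n = {0})"

text \<open>The radical, i.e. the largest solvable ideal, vanishes.\<close>

definition semisimple ::
    "('k::field \<Rightarrow> 'a::ab_group_add \<Rightarrow> 'a) \<Rightarrow> ('a \<Rightarrow> 'a \<Rightarrow> 'a) \<Rightarrow> bool" where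
  "semisimple s br \<longleftrightarrow> (\<forall>I. lie_ideal s br I \<and> solvable s br I \<longrightarrow> I = {0})"

definition is_basis :: "('k::field \<Rightarrow> 'a::ab_group_add \<Rightarrow> 'a) \<Rightarrow> 'a set \<Rightarrow> bool" where
  "is_basis s B \<longleftrightarrow> \<not> module.dependent s B \<and> module.span s B = UNIV"

definition trace :: "('k::field \<Rightarrow> 'a::ab_group_add \<Rightarrow> 'a) \<Rightarrow> ('a \<Rightarrow> 'a) \<Rightarrow> 'k" where
  "trace s f = (let B = (SOME B. is_basis s B) in \<Sum>b\<in>B. module.representation s B (f b) b)"

definition killing ::
    "('k::field \<Rightarrow> 'a::ab_group_add \<Rightarrow> 'a) \<Rightarrow> ('a \<Rightarrow> 'a \<Rightarrow> 'a) \<Rightarrow> 'a \<Rightarrow> 'a \<Rightarrow> 'k" where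
  "killing s br x y = trace s (br x \<circ> br y)"


section \<open>Maximal tori, roots and graded subalgebras\<close>

text \<open>
  Over an algebraically closed field an endomorphism is semisimple iff it is diagonalizable.
\<close>

definition diagonalizable :: "('k::field \<Rightarrow> 'a::ab_group_add \<Rightarrow> 'a) \<Rightarrow> ('a \<Rightarrow> 'a) \<Rightarrow> bool" where
  "diagonalizable s f \<longleftrightarrow> (\<exists>B. is_basis s B \<and> (\<forall>b\<in>B. \<exists>c. f b = s c b))"

definition torus ::
    "('k::field \<Rightarrow> 'a::ab_group_add \<Rightarrow> 'a) \<Rightarrow> ('a \<Rightarrow> 'a \<Rightarrow> 'a) \<Rightarrow> 'a set \<Rightarrow> bool" where
  "torus s br T \<longleftrightarrow> lie_subalgebra s br T \<and> (\<forall>h\<in>T. diagonalizable s (br h))"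

definition maximal_torus ::
    "('k::field \<Rightarrow> 'a::ab_group_add \<Rightarrow> 'a) \<Rightarrow> ('a \<Rightarrow> 'a \<Rightarrow> 'a) \<Rightarrow> 'a set \<Rightarrow> bool" where
  "maximal_torus s br H \<longleftrightarrow> torus s br H \<and> (\<forall>T. torus s br T \<and> H \<subseteq> T \<longrightarrow> T = H)"

text \<open>
  A linear functional on a subspace \<open>H\<close> is represented by the function on the whole type that
  extends it by 0 outside \<open>H\<close>, so that equality of functionals is equality of functions.
\<close>

definition dual_space ::
    "('k::field \<Rightarrow> 'a::ab_group_add \<Rightarrow> 'a) \<Rightarrow> 'a set \<Rightarrow> ('a \<Rightarrow> 'k) set" where
  "dual_space s H = {\<alpha>. (\<forall>x\<in>H. \<forall>y\<in>H. \<alpha> (x + y) = \<alpha> x + \<alpha> y) \<and>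
                        (\<forall>c. \<forall>x\<in>H. \<alpha> (s c x) = c * \<alpha> x) \<and> (\<forall>x. x \<notin> H \<longrightarrow> \<alpha> x = 0)}"

definition root_space ::
    "('k::field \<Rightarrow> 'a::ab_group_add \<Rightarrow> 'a) \<Rightarrow> ('a \<Rightarrow> 'a \<Rightarrow> 'a) \<Rightarrow> 'a set \<Rightarrow> ('a \<Rightarrow> 'k) \<Rightarrow> 'a set" where
  "root_space s br H \<alpha> = {x. \<forall>h\<in>H. br h x = s (\<alpha> h) x}"

definition roots ::
    "('k::field \<Rightarrow> 'a::ab_group_add \<Rightarrow> 'a) \<Rightarrow> ('a \<Rightarrow> 'a \<Rightarrow> 'a) \<Rightarrow> 'a set \<Rightarrow> ('a \<Rightarrow> 'k) set" where
  "roots s br H = {\<alpha> \<in> dual_space s H. \<alpha> \<noteq> 0 \<and> root_space s br H \<alpha> \<noteq> {0}}"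

definition int_span :: "('a \<Rightarrow> 'k::field) set \<Rightarrow> ('a \<Rightarrow> 'k) set" where
  "int_span \<Psi> = module.span (\<lambda>(n::int) \<alpha> x. of_int n * \<alpha> x) \<Psi>"

text \<open>
  The sum of \<open>H\<close> and of the root spaces is automatically direct, since these are simultaneous
  eigenspaces for \<open>H\<close> with distinct weights.
\<close>

definition Q_graded ::
    "('k::field \<Rightarrow> 'a::ab_group_add \<Rightarrow> 'a) \<Rightarrow> ('a \<Rightarrow> 'a \<Rightarrow> 'a) \<Rightarrow> 'a set \<Rightarrow> 'a set \<Rightarrow> bool" where
  "Q_graded s br H L \<longleftrightarrow> lie_subalgebra s br L \<and>
     (\<exists>\<Psi> \<subseteq> roots s br H. L = module.span s (H \<union> (\<Union>\<alpha>\<in>\<Psi>. root_space s br H \<alpha>)) \<and>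
        int_span \<Psi> = int_span (roots s br H))"

definition minimal_Q_graded ::
    "('k::field \<Rightarrow> 'a::ab_group_add \<Rightarrow> 'a) \<Rightarrow> ('a \<Rightarrow> 'a \<Rightarrow> 'a) \<Rightarrow> 'a set \<Rightarrow> 'a set \<Rightarrow> bool" where
  "minimal_Q_graded s br H L \<longleftrightarrow> Q_graded s br H L \<and> \<not> (\<exists>L1. Q_graded s br H L1 \<and> L1 \<subset> L)"


section \<open>Affinization\<close>

text \<open>
  An element of \<open>L \<otimes> F[t, t\<^sup>-\<^sup>1]\<close> is a Laurent polynomial with coefficients in \<open>L\<close>, i.e. a finitely
  supported function on the integers; \<open>x \<otimes> t\<^sup>n\<close> is \<open>single n x\<close>. The second component of a pair is
  the coefficient of the central element \<open>K\<close>.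
\<close>

type_synonym ('k, 'a) affine = "(int \<Rightarrow>\<^sub>0 'a) \<times> 'k"

definition loop :: "'a::zero \<Rightarrow> int \<Rightarrow> ('k::zero, 'a) affine" where
  "loop x n = (Poly_Mapping.single n x, 0)"

definition central_K :: "('k::zero_neq_one, 'a::zero) affine" where
  "central_K = (0, 1)"

definition loop_space :: "'a::zero set \<Rightarrow> ('k::zero, 'a) affine set" where
  "loop_space A = {(f, 0) | f. \<forall>n. Poly_Mapping.lookup f n \<in> A}"

definition affinization :: "'a::zero set \<Rightarrow> ('k, 'a) affine set" where
  "affinization A = {(f, c). \<forall>n. Poly_Mapping.lookup f n \<in> A}"

definition aff_scale ::
    "('k::field \<Rightarrow> 'a::ab_group_add \<Rightarrow> 'a) \<Rightarrow> 'k \<Rightarrow> ('k, 'a) affine \<Rightarrow> ('k, 'a) affine" where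
  "aff_scale s c u = (Poly_Mapping.map (s c) (fst u), c * snd u)"

text \<open>
  The form is the Killing form of the ambient algebra, also when this bracket is restricted to
  the affinization of a subalgebra.
\<close>

definition aff_bracket ::
    "('k::field \<Rightarrow> 'a::ab_group_add \<Rightarrow> 'a) \<Rightarrow> ('a \<Rightarrow> 'a \<Rightarrow> 'a) \<Rightarrow>
     ('k, 'a) affine \<Rightarrow> ('k, 'a) affine \<Rightarrow> ('k, 'a) affine" where
  "aff_bracket s br u v =
     (let f = fst u; g = fst v in
      (\<Sum>m\<in>Poly_Mapping.keys f. \<Sum>n\<in>Poly_Mapping.keys g.
         Poly_Mapping.single (m + n) (br (Poly_Mapping.lookup f m) (Poly_Mapping.lookup g n)),
       \<Sum>m\<in>Poly_Mapping.keys f. \<Sum>n\<in>Poly_Mapping.keys g.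
         if m + n = 0
         then of_int m * killing s br (Poly_Mapping.lookup f m) (Poly_Mapping.lookup g n)
         else 0))"


section \<open>Almost inner derivations\<close>

text \<open>
  Linear endomorphisms of a subspace \<open>M\<close> are represented by functions on the whole type that vanish
  outside \<open>M\<close>; this set is closed under the pointwise operations.
\<close>

definition endomorphisms ::
    "('k::field \<Rightarrow> 'b::ab_group_add \<Rightarrow> 'b) \<Rightarrow> 'b set \<Rightarrow> ('b \<Rightarrow> 'b) set" where
  "endomorphisms s M = {D. (\<forall>x\<in>M. D x \<in> M) \<and> (\<forall>x\<in>M. \<forall>y\<in>M. D (x + y) = D x + D y) \<and>
                           (\<forall>c. \<forall>x\<in>M. D (s c x) = s c (D x)) \<and> (\<forall>x. x \<notin> M \<longrightarrow> D x = 0)}"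

definition derivations ::
    "('k::field \<Rightarrow> 'b::ab_group_add \<Rightarrow> 'b) \<Rightarrow> ('b \<Rightarrow> 'b \<Rightarrow> 'b) \<Rightarrow> 'b set \<Rightarrow> ('b \<Rightarrow> 'b) set" where
  "derivations s br M =
     {D \<in> endomorphisms s M. \<forall>x\<in>M. \<forall>y\<in>M. D (br x y) = br (D x) y + br x (D y)}"

definition AID ::
    "('k::field \<Rightarrow> 'b::ab_group_add \<Rightarrow> 'b) \<Rightarrow> ('b \<Rightarrow> 'b \<Rightarrow> 'b) \<Rightarrow> 'b set \<Rightarrow> ('b \<Rightarrow> 'b) set" where
  "AID s br M = {D \<in> derivations s br M. \<forall>x\<in>M. D x \<in> {br x y | y. y \<in> M}}"

definition Inn :: "('b::ab_group_add \<Rightarrow> 'b \<Rightarrow> 'b) \<Rightarrow> 'b set \<Rightarrow> ('b \<Rightarrow> 'b) set" where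
  "Inn br M = {(\<lambda>x. if x \<in> M then br y x else 0) | y. y \<in> M}"


section \<open>Quotients and pointwise sums\<close>

text \<open>
  The quotient by a subspace \<open>N\<close> consists of cosets \<open>D +o N\<close>, with the addition of sets from
  \<^theory>\<open>HOL-Library.Set_Algebras\<close>, with \<open>coset_scale\<close>, and with zero element \<open>N\<close>. The empty sum of
  sets is \<open>{0}\<close> rather than \<open>N\<close>, which is harmless in \<open>coset_independent\<close>: the condition
  is void for \<open>J = {}\<close>.
\<close>

definition coset_scale ::
    "('k \<Rightarrow> 'v \<Rightarrow> 'v) \<Rightarrow> 'v::ab_group_add set \<Rightarrow> 'k \<Rightarrow> 'v set \<Rightarrow> 'v set" where
  "coset_scale s N c X = s c ` X + N"

definition coset_independent ::
    "('k::field \<Rightarrow> 'v \<Rightarrow> 'v) \<Rightarrow> 'v::ab_group_add set \<Rightarrow> 'i set \<Rightarrow> ('i \<Rightarrow> 'v set) \<Rightarrow> bool" where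
  "coset_independent s N I X \<longleftrightarrow>
     (\<forall>J c. finite J \<and> J \<subseteq> I \<and> (\<Sum>i\<in>J. coset_scale s N (c i) (X i)) = N \<longrightarrow> (\<forall>i\<in>J. c i = 0))"

definition map_scale :: "('k \<Rightarrow> 'b \<Rightarrow> 'b) \<Rightarrow> 'k \<Rightarrow> ('b \<Rightarrow> 'b) \<Rightarrow> 'b \<Rightarrow> 'b" where
  "map_scale s c D = (\<lambda>x. s c (D x))"

definition pointwise_finite :: "'i set \<Rightarrow> ('i \<Rightarrow> 'b \<Rightarrow> 'c::zero) \<Rightarrow> bool" where
  "pointwise_finite I F \<longleftrightarrow> (\<forall>x. finite {i \<in> I. F i x \<noteq> 0})"

definition pointwise_sum :: "'i set \<Rightarrow> ('i \<Rightarrow> 'b \<Rightarrow> 'c::comm_monoid_add) \<Rightarrow> 'b \<Rightarrow> 'c" where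
  "pointwise_sum I F = (\<lambda>x. \<Sum>i \<in> {i \<in> I. F i x \<noteq> 0}. F i x)"


section \<open>The maps \<open>D\<^sub>i\<^sub>j\<close>\<close>

definition D_spec ::
    "('k::field \<Rightarrow> 'a::ab_group_add \<Rightarrow> 'a) \<Rightarrow> ('a \<Rightarrow> 'a \<Rightarrow> 'a) \<Rightarrow> 'a set \<Rightarrow> nat \<Rightarrow> (nat \<Rightarrow> 'a) \<Rightarrow>
     nat \<Rightarrow> int \<Rightarrow> (('k, 'a) affine \<Rightarrow> ('k, 'a) affine) \<Rightarrow> bool" where
  "D_spec s br L l h i j D \<longleftrightarrow>
     D \<in> endomorphisms (aff_scale s) (affinization L) \<and>
     (\<forall>x \<in> loop_space (lie_product s br L L). D x = 0) \<and>
     D central_K = 0 \<and>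
     (\<forall>m\<in>{1..l}. \<forall>n. D (loop (h m) n) = (if i = m \<and> j = n then central_K else 0))"

definition D_map ::
    "('k::field \<Rightarrow> 'a::ab_group_add \<Rightarrow> 'a) \<Rightarrow> ('a \<Rightarrow> 'a \<Rightarrow> 'a) \<Rightarrow> 'a set \<Rightarrow> nat \<Rightarrow> (nat \<Rightarrow> 'a) \<Rightarrow>
     nat \<Rightarrow> int \<Rightarrow> ('k, 'a) affine \<Rightarrow> ('k, 'a) affine" where
  "D_map s br L l h i j = (THE D. D_spec s br L l h i j D)"

text \<open>
  A pitfall: the maps with \<open>j = 0\<close> are derivations, but never almost inner. Indeed
  \<open>D\<^sub>i\<^sub>0 (h\<^sub>i \<otimes> 1) = K\<close>, whereas the factor \<open>m\<close> in the cocycle makes the \<open>K\<close>-component of every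
  element of \<open>[h\<^sub>i \<otimes> t\<^sup>0, M]\<close> vanish. Hence \<open>j = 0\<close> has to be excluded wherever membership in
  \<open>AID\<close> is asserted.
\<close>

lemma D_zero_not_almost_inner:
  fixes L :: "'a::ab_group_add set" and s :: "'k::field \<Rightarrow> 'a \<Rightarrow> 'a"
  assumes spec: "D_spec s br L l h i 0 D" and i: "i \<in> {1..l}"
    and hL: "h i \<in> L" and zL: "0 \<in> L"
  shows "D \<notin> AID (aff_scale s) (aff_bracket s br) (affinization L)"
proof
  let ?x = "loop (h i) 0 :: ('k, 'a) affine"
  assume D: "D \<in> AID (aff_scale s) (aff_bracket s br) (affinization L)"
  have x: "?x \<in> affinization L"
    using hL zL by (simp add: loop_def affinization_def lookup_single when_def)
  have "D ?x = central_K"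
    using spec i by (simp add: D_spec_def)
  moreover obtain y where "D ?x = aff_bracket s br ?x y"
    using D x unfolding AID_def by blast
  ultimately have "snd (aff_bracket s br ?x y) = 1"
    by (metis central_K_def snd_conv)
  moreover have "snd (aff_bracket s br ?x y) = 0"
    by (auto simp: aff_bracket_def loop_def Let_def intro!: sum.neutral split: if_splits)
  ultimately show False by simp
qed

end

theory Submission
  imports Defs
begin

text \<open>
  Since the center of the ambient algebra is trivial, its roots separate the points of \<open>H\<close>, and
  so do the roots of \<open>L\<close>, which span the same lattice. Comparing dimensions, \<open>dim L = 2 dim [L, L]\<close>
  forces the roots of \<open>L\<close> to be a basis of the dual of \<open>H\<close>, with one-dimensional root spaces: \<open>L\<close>
  is a direct sum of two-dimensional algebras with \<open>[e\<^sub>i, x\<^sub>i] = x\<^sub>i\<close>. The \<open>e\<^sub>i\<close> take integral values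
  at all roots, so the trace form on them is an integer Gram matrix, all of whose principal minors
  are nonzero; this is what makes the maps \<open>D\<^sub>i\<^sub>j\<close> with \<open>j \<noteq> 0\<close> almost inner.

  Conversely, subtract from an almost inner derivation the inner derivation that agrees with it on
  all \<open>e\<^sub>i\<close> and \<open>x\<^sub>i\<close>. Applied to \<open>[e\<^sub>i \<otimes> t\<^sup>n, x\<^sub>i] = x\<^sub>i \<otimes> t\<^sup>n\<close> and \<open>[e\<^sub>i \<otimes> t\<^sup>n, e\<^sub>i] = 0\<close>, the
  derivation property shows that the difference kills \<open>x\<^sub>i \<otimes> t\<^sup>n\<close> and maps \<open>e\<^sub>i \<otimes> t\<^sup>n\<close> to the center.
\<close>

section \<open>Trace and Killing form\<close>

text \<open>The ground field has no order, so positivity of the Gram matrix has to be used over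
  \<rat>. This is possible because the Killing form on the vectors \<open>e\<^sub>i\<close> is a sum
  of products of integers, indexed by a weight basis of the ambient algebra. All principal minors
  are needed, not only the determinant. A central value at \<open>u\<close> is produced by
  bracketing \<open>u\<close> with a shifted copy of one of its components, and only components in
  which \<open>u\<close> has a nonzero coordinate along some \<open>e\<^sub>k\<close> can
  contribute. These form a set depending on \<open>u\<close>, and the required \<open>k\<close> must
  be found inside it. The inner derivation to be subtracted exists because almost innerness confines
  values: the loop parts of the images of \<open>e\<^sub>i \<otimes> t\<^sup>n\<close> and
  \<open>x\<^sub>i \<otimes> t\<^sup>n\<close> lie in \<open>x\<^sub>i \<otimes> S\<close>. At
  \<open>n = 0\<close> the resulting coefficients are, up to sign, the coordinates of one element
  \<open>y\<close>. What remains is a central value for each \<open>i\<close> and each degree, free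
  except in degree 0, where the cocycle vanishes. Nothing bounds the set of degrees that occur,
  hence the infinite sums.\<close>

context vector_space
begin

lemma span_image_sum:
  assumes "finite I" "v \<in> span (f ` I)"
  shows "\<exists>c. v = (\<Sum>i\<in>I. scale (c i) (f i))"
  using assms(2)
proof (induction rule: span_induct_alt)
  case base
  show ?case by (rule exI[of _ "\<lambda>_. 0"]) simp
next
  case (step c x y)
  then obtain i d where i: "i \<in> I" "x = f i" and d: "y = (\<Sum>i\<in>I. scale (d i) (f i))" by auto
  have "(\<Sum>j\<in>I. scale (d j + (if j = i then c else 0)) (f j)) = y + scale c x"
    using i assms(1) by (simp add: scale_left_distrib sum.distrib d if_distrib[of "\<lambda>t. scale t _"] cong: if_cong)
  then show ?case by (intro exI[of _ "\<lambda>j. d j + (if j = i then c else 0)"]) (simp add: add.commute)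
qed

text \<open>Needed over two fields: over \<rat>, with the ground field as the vector space, for the
  Gram matrix, and over the ground field for a functional normalised at a root vector.\<close>

lemma linear_functional_nonzero:
  assumes "x \<noteq> 0"
  shows "\<exists>\<phi>. (\<forall>u v. \<phi> (u + v) = \<phi> u + \<phi> v) \<and> (\<forall>c u. \<phi> (scale c u) = c * \<phi> u) \<and> \<phi> x = 1"
proof -
  have ind: "independent {x}" using assms by simp
  let ?B = "extend_basis {x}"
  have B: "independent ?B" "span ?B = UNIV" "x \<in> ?B"
    using independent_extend_basis[OF ind] span_extend_basis[OF ind] extend_basis_superset[OF ind]
    by auto
  show ?thesis
    by (rule exI[of _ "\<lambda>v. representation ?B v x"])
       (use B in \<open>auto simp: representation_add representation_scale representation_basis\<close>)
qed

end

context lie_algebra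
begin

lemma bracket_zero_left [simp]: "bracket 0 y = 0"
  using bracket_add_left[of 0 0 y] by simp

lemma bracket_zero_right [simp]: "bracket x 0 = 0"
  using bracket_add_right[of x 0 0] by simp

lemma bracket_anti: "bracket x y = - bracket y x"
proof -
  have "bracket x y + bracket y x = bracket (x + y) (x + y)"
    unfolding bracket_add_left bracket_add_right by (simp add: bracket_self)
  also have "\<dots> = 0" by (rule bracket_self)
  finally have "bracket x y + bracket y x = 0" .
  then show ?thesis by (simp add: eq_neg_iff_add_eq_0)
qed

lemma bracket_minus_right: "bracket x (- y) = - bracket x y"
  using bracket_add_right[of x y "- y"] by (simp add: eq_neg_iff_add_eq_0 add.commute)

lemma bracket_diff_right: "bracket x (y - z) = bracket x y - bracket x z"
  using bracket_add_right[of x y "- z"] by (simp add: bracket_minus_right)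

lemma linear_bracket: "Vector_Spaces.linear scale scale (bracket x)"
  by unfold_locales (auto simp: bracket_add_right bracket_scale_right)

lemma bracket_sum_right: "bracket x (\<Sum>i\<in>I. f i) = (\<Sum>i\<in>I. bracket x (f i))"
  by (induction I rule: infinite_finite_induct) (auto simp: bracket_add_right)

lemma bracket_sum_left: "bracket (\<Sum>i\<in>I. f i) y = (\<Sum>i\<in>I. bracket (f i) y)"
  by (induction I rule: infinite_finite_induct) (auto simp: bracket_add_left)

lemma jacobi_left: "bracket (bracket x y) z = bracket x (bracket y z) - bracket y (bracket x z)"
proof -
  have "bracket z (bracket x y) = - (bracket x (bracket y z) + bracket y (bracket z x))"
    using jacobi[of x y z] by (metis add.commute eq_neg_iff_add_eq_0)
  moreover have "bracket y (bracket z x) = - bracket y (bracket x z)"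
    by (simp add: bracket_anti[of z x] bracket_minus_right)
  ultimately show ?thesis
    by (simp add: bracket_anti[of "bracket x y" z])
qed

end

section \<open>Traces in finite dimension\<close>

locale fd_lie_algebra = lie_algebra scale bracket
  for scale :: "'k::field \<Rightarrow> 'a::ab_group_add \<Rightarrow> 'a" and bracket :: "'a \<Rightarrow> 'a \<Rightarrow> 'a" +
  assumes fd: "finite_dimensional scale"
begin

lemma independent_finite: "independent B \<Longrightarrow> finite B"
  using fd independent_span_bound unfolding finite_dimensional_def by blast

lemma is_basis_finite: "is_basis scale B \<Longrightarrow> finite B"
  by (simp add: is_basis_def independent_finite)

lemma ex_basis_subset:
  assumes "span S = UNIV"
  shows "\<exists>B\<subseteq>S. is_basis scale B"
proof -
  obtain B where "B \<subseteq> S" "independent B" "S \<subseteq> span B"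
    using maximal_independent_subset[of S] by blast
  moreover from this have "span B = UNIV"
    using assms span_mono[of S "span B"] by (auto simp: span_span)
  ultimately show ?thesis by (auto simp: is_basis_def)
qed

lemma ex_is_basis: "\<exists>B. is_basis scale B"
  using ex_basis_subset[of UNIV] by (auto simp: span_UNIV)

text \<open>The matrix product formula: at \<open>v = g b\<close> it expands a diagonal entry of
  \<open>f \<circ> g\<close>, which turns \<open>trace_commute\<close> into an exchange of two
  sums.\<close>

lemma trace_comp_aux:
  assumes B: "is_basis scale B" and f: "Vector_Spaces.linear scale scale f"
  shows "representation B (f v) b = (\<Sum>c\<in>B. representation B v c * representation B (f c) b)"
proof -
  interpret f: Vector_Spaces.linear scale scale f by fact
  have ind: "independent B" and sp: "span B = UNIV" using B by (auto simp: is_basis_def)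
  have "f v = f (\<Sum>c\<in>B. scale (representation B v c) c)"
    using ind sp is_basis_finite[OF B] by (subst sum_representation_eq) auto
  also have "\<dots> = (\<Sum>c\<in>B. scale (representation B v c) (f c))"
    by (simp add: f.sum f.scale)
  finally show ?thesis
    using ind sp by (simp add: representation_sum representation_scale)
qed

text \<open>Expanding each \<open>b\<close> in \<open>C\<close>, or each \<open>f c\<close> in
  \<open>B\<close>, turns either side into the same double sum. Since \<open>trace\<close> uses an
  unspecified basis, computing it in a weight basis rests on this.\<close>

lemma trace_basis_independent:
  assumes B: "is_basis scale B" and C: "is_basis scale C" and f: "Vector_Spaces.linear scale scale f"
  shows "(\<Sum>b\<in>B. representation B (f b) b) = (\<Sum>c\<in>C. representation C (f c) c)"
proof -
  interpret f: Vector_Spaces.linear scale scale f by fact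
  have iB: "independent B" and sB: "span B = UNIV" and iC: "independent C" and sC: "span C = UNIV"
    using B C by (auto simp: is_basis_def)
  note fin = is_basis_finite[OF B] is_basis_finite[OF C]
  have "(\<Sum>b\<in>B. representation B (f b) b)
      = (\<Sum>b\<in>B. \<Sum>c\<in>C. representation C b c * representation B (f c) b)"
  proof (rule sum.cong[OF refl])
    fix b assume "b \<in> B"
    have "f b = f (\<Sum>c\<in>C. scale (representation C b c) c)"
      using iC sC fin by (subst sum_representation_eq) auto
    also have "\<dots> = (\<Sum>c\<in>C. scale (representation C b c) (f c))"
      by (simp add: f.sum f.scale)
    finally show "representation B (f b) b = (\<Sum>c\<in>C. representation C b c * representation B (f c) b)"
      using iB sB by (simp add: representation_sum representation_scale)
  qed
  also have "\<dots> = (\<Sum>c\<in>C. \<Sum>b\<in>B. representation C b c * representation B (f c) b)"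
    by (rule sum.swap)
  also have "\<dots> = (\<Sum>c\<in>C. representation C (f c) c)"
  proof (rule sum.cong[OF refl])
    fix c assume "c \<in> C"
    have "f c = (\<Sum>b\<in>B. scale (representation B (f c) b) b)"
      using iB sB fin by (subst sum_representation_eq) auto
    then have "representation C (f c) c
        = representation C (\<Sum>b\<in>B. scale (representation B (f c) b) b) c" by simp
    then show "(\<Sum>b\<in>B. representation C b c * representation B (f c) b) = representation C (f c) c"
      using iC sC by (simp add: representation_sum representation_scale mult.commute)
  qed
  finally show ?thesis .
qed

lemma trace_eq:
  assumes B: "is_basis scale B" and f: "Vector_Spaces.linear scale scale f"
  shows "trace scale f = (\<Sum>b\<in>B. representation B (f b) b)"
  using trace_basis_independent[OF someI_ex[OF ex_is_basis] B f] by (simp add: trace_def Let_def)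

lemma trace_commute:
  assumes f: "Vector_Spaces.linear scale scale f" and g: "Vector_Spaces.linear scale scale g"
  shows "trace scale (f \<circ> g) = trace scale (g \<circ> f)"
proof -
  obtain B where B: "is_basis scale B" using ex_is_basis by blast
  have fg: "Vector_Spaces.linear scale scale (f \<circ> g)" "Vector_Spaces.linear scale scale (g \<circ> f)"
    using Vector_Spaces.linear_compose[OF f g] Vector_Spaces.linear_compose[OF g f] by auto
  show ?thesis
    unfolding trace_eq[OF B fg(1)] trace_eq[OF B fg(2)] o_apply
    by (subst trace_comp_aux[OF B f], subst trace_comp_aux[OF B g], subst sum.swap)
       (simp add: mult.commute)
qed

lemma trace_add:
  assumes f: "Vector_Spaces.linear scale scale f" and g: "Vector_Spaces.linear scale scale g"
  shows "trace scale (\<lambda>v. f v + g v) = trace scale f + trace scale g"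
proof -
  obtain B where B: "is_basis scale B" using ex_is_basis by blast
  interpret f: Vector_Spaces.linear scale scale f by fact
  interpret g: Vector_Spaces.linear scale scale g by fact
  have fg: "Vector_Spaces.linear scale scale (\<lambda>v. f v + g v)"
    by unfold_locales (auto simp: f.add g.add f.scale g.scale scale_right_distrib)
  have "independent B" "span B = UNIV" using B by (auto simp: is_basis_def)
  then show ?thesis
    unfolding trace_eq[OF B fg] trace_eq[OF B f] trace_eq[OF B g]
    by (simp add: representation_add sum.distrib)
qed

lemma trace_scale:
  assumes f: "Vector_Spaces.linear scale scale f"
  shows "trace scale (\<lambda>v. scale c (f v)) = c * trace scale f"
proof -
  obtain B where B: "is_basis scale B" using ex_is_basis by blast
  interpret f: Vector_Spaces.linear scale scale f by fact
  have cf: "Vector_Spaces.linear scale scale (\<lambda>v. scale c (f v))"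
    by unfold_locales (auto simp: f.add f.scale scale_right_distrib mult.commute)
  have "independent B" "span B = UNIV" using B by (auto simp: is_basis_def)
  then show ?thesis
    unfolding trace_eq[OF B cf] trace_eq[OF B f]
    by (simp add: representation_scale sum_distrib_left)
qed

section \<open>Bilinearity, symmetry and invariance of the Killing form\<close>

abbreviation K where "K \<equiv> killing scale bracket"

lemma linear_bracket2: "Vector_Spaces.linear scale scale (bracket x \<circ> bracket y)"
  by (rule Vector_Spaces.linear_compose[OF linear_bracket linear_bracket])

lemma killing_sym: "K x y = K y x"
  unfolding killing_def by (rule trace_commute; rule linear_bracket)

lemma killing_add_left: "K (x + y) z = K x z + K y z"
proof -
  have "bracket (x + y) \<circ> bracket z = (\<lambda>v. (bracket x \<circ> bracket z) v + (bracket y \<circ> bracket z) v)"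
    by (auto simp: bracket_add_left)
  then show ?thesis unfolding killing_def by (simp only: trace_add linear_bracket2)
qed

lemma killing_scale_left: "K (scale c x) z = c * K x z"
proof -
  have "bracket (scale c x) \<circ> bracket z = (\<lambda>v. scale c ((bracket x \<circ> bracket z) v))"
    by (auto simp: bracket_scale_left)
  then show ?thesis unfolding killing_def by (simp only: trace_scale linear_bracket2)
qed

lemma killing_add_right: "K z (x + y) = K z x + K z y"
  by (simp add: killing_sym[of z] killing_add_left)

lemma killing_scale_right: "K z (scale c x) = c * K z x"
  by (simp add: killing_sym[of z] killing_scale_left)

lemma killing_zero_left [simp]: "K 0 z = 0"
  using killing_scale_left[of 0 0 z] by simp

lemma killing_zero_right [simp]: "K z 0 = 0"
  using killing_scale_right[of z 0 0] by simp

lemma killing_sum_left: "K (\<Sum>i\<in>I. f i) z = (\<Sum>i\<in>I. K (f i) z)"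
  by (induction I rule: infinite_finite_induct) (auto simp: killing_add_left)

text \<open>Expanding the commutators leaves a common trace on both sides, minus the traces
  belonging to the orders \<open>y, x, z\<close> and \<open>x, z, y\<close>; these agree by
  cyclicity.\<close>

lemma killing_invariant: "K (bracket x y) z = K x (bracket y z)"
proof -
  let ?t = "\<lambda>a b c. trace scale (bracket a \<circ> (bracket b \<circ> bracket c))"
  have lin3: "Vector_Spaces.linear scale scale (bracket a \<circ> (bracket b \<circ> bracket c))" for a b c
    by (rule Vector_Spaces.linear_compose[OF linear_bracket2 linear_bracket])
  have linm: "Vector_Spaces.linear scale scale (\<lambda>v. scale (-1) ((bracket a \<circ> (bracket b \<circ> bracket c)) v))" for a b c
    by unfold_locales (auto simp: bracket_add_right bracket_scale_right)
  have 1: "K (bracket x y) z = ?t x y z - ?t y x z"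
  proof -
    have "bracket (bracket x y) \<circ> bracket z = (\<lambda>v. (bracket x \<circ> (bracket y \<circ> bracket z)) v
        + scale (-1) ((bracket y \<circ> (bracket x \<circ> bracket z)) v))"
      by (auto simp: jacobi_left)
    then show ?thesis
      unfolding killing_def by (simp only: trace_add[OF lin3 linm] trace_scale[OF lin3]) simp
  qed
  have 2: "K x (bracket y z) = ?t x y z - ?t x z y"
  proof -
    have "bracket x \<circ> bracket (bracket y z) = (\<lambda>v. (bracket x \<circ> (bracket y \<circ> bracket z)) v
        + scale (-1) ((bracket x \<circ> (bracket z \<circ> bracket y)) v))"
      by (auto simp: jacobi_left bracket_diff_right)
    then show ?thesis
      unfolding killing_def by (simp only: trace_add[OF lin3 linm] trace_scale[OF lin3]) simp
  qed
  have "?t y x z = trace scale ((bracket x \<circ> bracket z) \<circ> bracket y)"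
    by (intro trace_commute linear_bracket linear_bracket2)
  then have "?t y x z = ?t x z y" by (simp add: o_assoc)
  then show ?thesis using 1 2 by simp
qed

end

section \<open>Weights\<close>

context fd_lie_algebra
begin

text \<open>Applying \<open>f - d\<close> removes the component for \<open>d\<close> and multiplies
  every other one by the nonzero scalar \<open>c - d\<close>, so the number of components drops. For
  \<open>W = {0}\<close> this is the independence of eigenvectors with distinct eigenvalues.\<close>

lemma eigen_components_mem:
  assumes W: "subspace W" and inv: "\<And>w. w \<in> W \<Longrightarrow> f w \<in> W"
    and f: "Vector_Spaces.linear scale scale f"
    and "finite C" and "\<And>c. c \<in> C \<Longrightarrow> f (v c) = scale c (v c)" and "(\<Sum>c\<in>C. v c) \<in> W"
  shows "\<forall>c\<in>C. v c \<in> W"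
  using assms(4-6)
proof (induction C arbitrary: v rule: finite_induct)
  case (insert d C)
  interpret f: Vector_Spaces.linear scale scale f by fact
  let ?w = "\<lambda>c. scale (c - d) (v c)"
  have "(\<Sum>c\<in>C. ?w c) = f (\<Sum>c\<in>insert d C. v c) - scale d (\<Sum>c\<in>insert d C. v c)"
    using insert.prems(1) insert.hyps
    by (simp add: f.add f.sum scale_right_distrib scale_sum_right scale_left_diff_distrib sum_subtractf)
  also have "\<dots> \<in> W"
    using W inv insert.prems(2) by (intro subspace_diff subspace_scale) auto
  finally have "\<forall>c\<in>C. ?w c \<in> W"
    using insert.prems(1) by (intro insert.IH) (auto simp: f.scale mult.commute)
  then have *: "v c \<in> W" if "c \<in> C" for c
  proof -
    have "c - d \<noteq> 0" using insert.hyps(2) that by auto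
    moreover have "scale (inverse (c - d)) (?w c) \<in> W"
      using \<open>\<forall>c\<in>C. ?w c \<in> W\<close> that by (blast intro: subspace_scale[OF W])
    ultimately show ?thesis by simp
  qed
  have "v d = (\<Sum>c\<in>insert d C. v c) - (\<Sum>c\<in>C. v c)"
    using insert.hyps by simp
  also have "\<dots> \<in> W"
    using * by (intro subspace_diff[OF W insert.prems(2)] subspace_sum[OF W])
  finally show ?case using * by auto
qed simp

text \<open>Basis vectors are grouped by eigenvalue, so that the components are indexed by distinct
  eigenvalues as \<open>eigen_components_mem\<close> demands. A component may be 0.\<close>

lemma diagonalizable_decomp:
  assumes f: "Vector_Spaces.linear scale scale f" and "diagonalizable scale f"
  obtains C v where "finite C" "\<And>c. c \<in> C \<Longrightarrow> f (v c) = scale c (v c)" "x = (\<Sum>c\<in>C. v c)"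
proof -
  interpret f: Vector_Spaces.linear scale scale f by fact
  obtain B where B: "is_basis scale B" and "\<forall>b\<in>B. \<exists>c. f b = scale c b"
    using assms(2) by (auto simp: diagonalizable_def)
  then obtain c where c: "\<And>b. b \<in> B \<Longrightarrow> f b = scale (c b) b" by metis
  note fin = is_basis_finite[OF B]
  let ?r = "representation B x"
  let ?v = "\<lambda>d. \<Sum>b\<in>{b\<in>B. c b = d}. scale (?r b) b"
  have "x = (\<Sum>b\<in>B. scale (?r b) b)"
    using B fin by (subst sum_representation_eq) (auto simp: is_basis_def)
  also have "\<dots> = (\<Sum>d\<in>c ` B. ?v d)"
    by (rule sum.image_gen[OF fin])
  finally have x: "x = (\<Sum>d\<in>c ` B. ?v d)" .
  show thesis
    by (rule that[of "c ` B" ?v])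
       (use x fin c in \<open>auto simp: f.sum f.scale scale_sum_right mult.commute intro!: sum.cong\<close>)
qed

section \<open>Independent and dual families\<close>

lemma independent_family:
  assumes "finite I" and z: "\<And>c i. (\<Sum>i\<in>I. scale (c i) (f i)) = 0 \<Longrightarrow> i \<in> I \<Longrightarrow> c i = 0"
  shows "inj_on f I" "independent (f ` I)"
proof -
  show inj: "inj_on f I"
  proof (rule inj_onI, rule ccontr)
    fix i j assume ij: "i \<in> I" "j \<in> I" "f i = f j" "i \<noteq> j"
    let ?c = "\<lambda>k. (if k = i then 1 else 0) - (if k = j then 1 else 0) :: 'k"
    have "(\<Sum>k\<in>I. scale (?c k) (f k)) = f i - f j"
      using ij assms(1)
      by (simp add: scale_left_diff_distrib sum_subtractf if_distrib[of "\<lambda>t. scale t _"] cong: if_cong)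
    then have "?c i = 0" using z[of ?c i] ij by simp
    then show False using ij by simp
  qed
  show "independent (f ` I)"
  proof
    assume "dependent (f ` I)"
    then obtain u b where u: "b \<in> f ` I" "u b \<noteq> 0" "(\<Sum>b\<in>f ` I. scale (u b) b) = 0"
      using assms(1) by (auto simp: dependent_finite)
    then have "(\<Sum>i\<in>I. scale (u (f i)) (f i)) = 0"
      by (simp add: sum.reindex[OF inj])
    with z[of "u \<circ> f"] u show False by auto
  qed
qed

text \<open>A dual family of maximal cardinality spans: otherwise a vector outside its span, corrected
  to be annihilated by the chosen functionals, is detected by a further functional.\<close>

lemma ex_dual_family:
  assumes W: "subspace W"
    and add: "\<And>\<alpha> u v. \<alpha> \<in> \<Psi> \<Longrightarrow> u \<in> W \<Longrightarrow> v \<in> W \<Longrightarrow> \<alpha> (u + v) = \<alpha> u + \<alpha> v"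
    and hom: "\<And>\<alpha> c u. \<alpha> \<in> \<Psi> \<Longrightarrow> u \<in> W \<Longrightarrow> \<alpha> (scale c u) = c * \<alpha> u"
    and sep: "\<And>w. w \<in> W \<Longrightarrow> (\<And>\<alpha>. \<alpha> \<in> \<Psi> \<Longrightarrow> \<alpha> w = 0) \<Longrightarrow> w = 0"
  obtains I e where "finite I" "I \<subseteq> \<Psi>" "\<And>\<alpha> \<beta>. \<alpha> \<in> I \<Longrightarrow> \<beta> \<in> I \<Longrightarrow> \<alpha> (e \<beta>) = (if \<alpha> = \<beta> then 1 else 0)"
    "W = span (e ` I)" "card I = dim W" "inj_on e I" "independent (e ` I)"
proof -
  have zero: "\<alpha> 0 = 0" if "\<alpha> \<in> \<Psi>" for \<alpha>
    using hom[OF that subspace_0[OF W], of 0] by simp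
  have lin: "\<alpha> (\<Sum>i\<in>I. scale (c i) (e i)) = (\<Sum>i\<in>I. c i * \<alpha> (e i))"
    if "\<alpha> \<in> \<Psi>" "e ` I \<subseteq> W" "finite I" for \<alpha> c e and I :: "('a \<Rightarrow> 'k) set"
    using that(3,2)
  proof (induction I rule: finite_induct)
    case (insert i I)
    have "(\<Sum>i\<in>I. scale (c i) (e i)) \<in> W"
      using insert W by (intro subspace_sum subspace_scale) auto
    then show ?case
      using insert W that(1) by (simp add: add hom subspace_scale)
  qed (use zero that(1) in auto)
  define good where "good I e \<longleftrightarrow> finite I \<and> I \<subseteq> \<Psi> \<and> e ` I \<subseteq> W \<and>
    (\<forall>\<alpha>\<in>I. \<forall>\<beta>\<in>I. \<alpha> (e \<beta>) = (if \<alpha> = \<beta> then 1 else 0))" for I and e :: "('a \<Rightarrow> 'k) \<Rightarrow> 'a"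
  have ind: "inj_on e I" "independent (e ` I)" if g: "good I e" for I e
  proof -
    have fin: "finite I" and sub: "I \<subseteq> \<Psi>" "e ` I \<subseteq> W"
      and dual: "\<And>\<alpha> \<beta>. \<alpha> \<in> I \<Longrightarrow> \<beta> \<in> I \<Longrightarrow> \<alpha> (e \<beta>) = (if \<alpha> = \<beta> then 1 else 0)"
      using g by (auto simp: good_def)
    have "c \<alpha> = 0" if z: "(\<Sum>\<beta>\<in>I. scale (c \<beta>) (e \<beta>)) = 0" and \<alpha>: "\<alpha> \<in> I" for c \<alpha>
    proof -
      have "0 = \<alpha> (\<Sum>\<beta>\<in>I. scale (c \<beta>) (e \<beta>))" using z zero \<alpha> sub by auto
      also have "\<dots> = (\<Sum>\<beta>\<in>I. c \<beta> * \<alpha> (e \<beta>))"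
        using \<alpha> sub fin by (intro lin) auto
      also have "\<dots> = c \<alpha>"
        using \<alpha> fin by (simp add: dual if_distrib[of "\<lambda>t. _ * t"] cong: if_cong)
      finally show ?thesis by simp
    qed
    then show "inj_on e I" "independent (e ` I)"
      using independent_family[OF fin, of e] by blast+
  qed
  define P where "P n \<longleftrightarrow> (\<exists>I e. good I e \<and> card I = n)" for n
  obtain F where F: "finite F" "span F = UNIV" using fd by (auto simp: finite_dimensional_def)
  have bound: "n \<le> card F" if "P n" for n
  proof -
    obtain I e where g: "good I e" "card I = n" using \<open>P n\<close> by (auto simp: P_def)
    then have "card (e ` I) = n" using ind(1) by (simp add: card_image)
    then show ?thesis using independent_span_bound[OF F(1) ind(2)[OF g(1)]] F(2) by simp
  qed
  have "P 0" unfolding P_def good_def by (rule exI[of _ "{}"]) simp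
  then have P: "P (Greatest P)" using bound by (rule GreatestI_nat)
  then obtain I e where g: "good I e" and card: "card I = Greatest P" by (auto simp: P_def)
  have fin: "finite I" and sub: "I \<subseteq> \<Psi>" "e ` I \<subseteq> W"
    and dual: "\<And>\<alpha> \<beta>. \<alpha> \<in> I \<Longrightarrow> \<beta> \<in> I \<Longrightarrow> \<alpha> (e \<beta>) = (if \<alpha> = \<beta> then 1 else 0)"
    using g by (auto simp: good_def)
  have "W \<subseteq> span (e ` I)"
  proof
    fix w assume w: "w \<in> W"
    define r where "r = w + scale (-1) (\<Sum>\<beta>\<in>I. scale (\<beta> w) (e \<beta>))"
    have sW: "(\<Sum>\<beta>\<in>I. scale (\<beta> w) (e \<beta>)) \<in> W"
      using sub W by (intro subspace_sum subspace_scale) auto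
    have rW: "r \<in> W"
      unfolding r_def using W w sW by (intro subspace_add subspace_scale)
    have r0: "\<alpha> r = 0" if \<alpha>: "\<alpha> \<in> I" for \<alpha>
    proof -
      have "\<alpha> r = \<alpha> w - \<alpha> (\<Sum>\<beta>\<in>I. scale (\<beta> w) (e \<beta>))"
        unfolding r_def using \<alpha> sub w W sW
        by (subst add, auto simp del: scale_minus_left scale_one intro: subspace_scale)
           (subst hom, auto)
      also have "\<alpha> (\<Sum>\<beta>\<in>I. scale (\<beta> w) (e \<beta>)) = (\<Sum>\<beta>\<in>I. \<beta> w * \<alpha> (e \<beta>))"
        using \<alpha> sub fin by (intro lin) auto
      also have "\<dots> = \<alpha> w"
        using \<alpha> fin by (simp add: dual if_distrib[of "\<lambda>t. _ * t"] cong: if_cong)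
      finally show ?thesis by simp
    qed
    have "r = 0"
    proof (rule sep[OF rW], rule ccontr)
      fix \<gamma> assume \<gamma>: "\<gamma> \<in> \<Psi>" "\<gamma> r \<noteq> 0"
      then have \<gamma>I: "\<gamma> \<notin> I" using r0 by auto
      define x where "x = scale (inverse (\<gamma> r)) r"
      have xW: "x \<in> W" using rW W by (simp add: x_def subspace_scale)
      have x1: "\<gamma> x = 1" using \<gamma> rW by (simp add: x_def hom)
      have x0: "\<alpha> x = 0" if "\<alpha> \<in> I" for \<alpha>
        using that rW sub r0 by (auto simp: x_def hom subset_iff)
      \<comment> \<open>The multiple of \<open>x\<close> makes \<open>\<gamma>\<close> vanish on the
        old vectors; the old functionals vanish on \<open>x\<close> and so keep their
        values.\<close>
      define e' where "e' \<beta> = (if \<beta> = \<gamma> then x else e \<beta> + scale (- \<gamma> (e \<beta>)) x)" for \<beta>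
      have e'W: "e' \<beta> \<in> W" if "\<beta> \<in> insert \<gamma> I" for \<beta>
        using that xW sub W unfolding e'_def by (auto intro!: subspace_add subspace_scale simp del: scale_minus_left)
      have val: "\<alpha> (e' \<beta>) = (if \<beta> = \<gamma> then \<alpha> x else \<alpha> (e \<beta>) - \<gamma> (e \<beta>) * \<alpha> x)"
        if "\<alpha> \<in> insert \<gamma> I" "\<beta> \<in> insert \<gamma> I" for \<alpha> \<beta>
      proof (cases "\<beta> = \<gamma>")
        case False
        then have "e \<beta> \<in> W" "\<alpha> \<in> \<Psi>" using that sub \<gamma> by auto
        then show ?thesis using False xW W
          unfolding e'_def by (simp del: scale_minus_left add: add hom subspace_scale)
      qed (simp add: e'_def)
      have "good (insert \<gamma> I) e'"
        unfolding good_def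
      proof (intro conjI ballI)
        fix \<alpha> \<beta> assume ab: "\<alpha> \<in> insert \<gamma> I" "\<beta> \<in> insert \<gamma> I"
        have "\<gamma> (e \<beta>) - \<gamma> (e \<beta>) * \<gamma> x = 0" using x1 by simp
        then show "\<alpha> (e' \<beta>) = (if \<alpha> = \<beta> then 1 else 0)"
          unfolding val[OF ab] using ab x0 x1 dual \<gamma>I by (cases "\<alpha> = \<gamma>"; cases "\<beta> = \<gamma>") simp_all
      next
        show "e' ` insert \<gamma> I \<subseteq> W" using e'W by blast
      qed (use fin sub \<gamma> in auto)
      then have "P (Suc (card I))"
        unfolding P_def using fin \<gamma>I by (intro exI[of _ "insert \<gamma> I"] exI[of _ e'] conjI) auto
      then have "Suc (card I) \<le> Greatest P" using bound by (rule Greatest_le_nat)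
      then show False using card by simp
    qed
    then have "w = (\<Sum>\<beta>\<in>I. scale (\<beta> w) (e \<beta>))" by (simp add: r_def)
    also have "\<dots> \<in> span (e ` I)" by (intro span_sum span_scale span_base) auto
    finally show "w \<in> span (e ` I)" .
  qed
  moreover have "span (e ` I) \<subseteq> W" using sub W by (simp add: span_minimal)
  ultimately have WI: "W = span (e ` I)" by auto
  have "dim W = card I"
    unfolding WI dim_span_eq_card_independent[OF ind(2)[OF g]] by (rule card_image[OF ind(1)[OF g]])
  show thesis
    by (rule that[OF fin sub(1) dual WI \<open>dim W = card I\<close>[symmetric] ind[OF g]])
qed

end

section \<open>The weights of a torus in a semisimple algebra\<close>

locale torus_algebra = fd_lie_algebra scale bracket
  for scale :: "'k::field_char_0 \<Rightarrow> 'a::ab_group_add \<Rightarrow> 'a" and bracket :: "'a \<Rightarrow> 'a \<Rightarrow> 'a" +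
  fixes H :: "'a set"
  assumes torus_H: "torus scale bracket H" and semisimple: "semisimple scale bracket"
begin

abbreviation "wspace \<equiv> root_space scale bracket H"
abbreviation "\<Phi> \<equiv> roots scale bracket H"

lemma subspace_H: "subspace H"
  using torus_H by (simp add: torus_def lie_subalgebra_def)

text \<open>Here \<open>bracket y x\<close> is a multiple of \<open>y\<close>, so applying
  \<open>bracket y\<close> to \<open>x\<close> twice gives 0. For a diagonalizable map, applying it
  once then already gives 0.\<close>

lemma torus_eigen_zero:
  assumes "x \<in> H" "y \<in> H" "bracket x y = scale c y"
  shows "bracket x y = 0"
proof -
  have dy: "diagonalizable scale (bracket y)" using torus_H assms(2) by (simp add: torus_def)
  obtain D w where D: "finite D" "\<And>d. d \<in> D \<Longrightarrow> bracket y (w d) = scale d (w d)" "x = (\<Sum>d\<in>D. w d)"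
    using diagonalizable_decomp[OF linear_bracket dy] by blast
  have yx: "bracket y x = (\<Sum>d\<in>D. scale d (w d))"
    using D(2) by (simp add: D(3) bracket_sum_right)
  have "bracket y (bracket y x) = 0"
    using assms(3) by (simp add: bracket_anti[of y x] bracket_minus_right bracket_scale_right bracket_self)
  then have "(\<Sum>d\<in>D. scale d (scale d (w d))) = 0"
    using D(2) by (simp add: yx bracket_sum_right bracket_scale_right)
  then have "\<forall>d\<in>D. scale d (scale d (w d)) \<in> {0}"
    using D(1,2) by (intro eigen_components_mem[where f = "bracket y"] linear_bracket)
      (auto simp: bracket_scale_right subspace_def)
  then have "bracket y x = 0" by (auto simp: yx intro!: sum.neutral)
  then show ?thesis by (simp add: bracket_anti[of x y])
qed

text \<open>The eigencomponents of \<open>y\<close> under \<open>bracket x\<close> stay in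
  \<open>H\<close>, and \<open>torus_eigen_zero\<close> rules out nonzero eigenvalues for
  them.\<close>

lemma torus_abelian:
  assumes "x \<in> H" "y \<in> H"
  shows "bracket x y = 0"
proof -
  have dx: "diagonalizable scale (bracket x)" using torus_H assms(1) by (simp add: torus_def)
  obtain D w where D: "finite D" "\<And>d. d \<in> D \<Longrightarrow> bracket x (w d) = scale d (w d)" "y = (\<Sum>d\<in>D. w d)"
    using diagonalizable_decomp[OF linear_bracket dx] by blast
  have inv: "bracket x z \<in> H" if "z \<in> H" for z
    using that assms(1) torus_H by (auto simp: torus_def lie_subalgebra_def)
  have "\<forall>d\<in>D. w d \<in> H"
    using D assms(2) inv by (intro eigen_components_mem[where f = "bracket x"] linear_bracket subspace_H) auto
  then have "\<forall>d\<in>D. bracket x (w d) = 0"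
    using torus_eigen_zero[OF assms(1)] D(2) by blast
  then show ?thesis by (simp add: D(3) bracket_sum_right)
qed

text \<open>The vectors with the same eigenvalues under \<open>F\<close> as a given \<open>v\<close>
  form a subspace \<open>W\<close>. It is invariant under the next element \<open>h\<close>, which
  commutes with \<open>F\<close>, so the eigencomponents of \<open>v\<close> under \<open>h\<close>
  remain in \<open>W\<close>.\<close>

lemma span_simultaneous_eigenvectors:
  assumes "finite F" "F \<subseteq> H"
  shows "span {v. \<forall>h\<in>F. \<exists>c. bracket h v = scale c v} = UNIV"
  using assms
proof (induction F rule: finite_induct)
  case empty
  show ?case by (simp add: span_UNIV)
next
  case (insert h F)
  let ?V = "\<lambda>F. {v. \<forall>h\<in>F. \<exists>c. bracket h v = scale c v}"
  have dh: "diagonalizable scale (bracket h)" using torus_H insert by (simp add: torus_def)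
  have "?V F \<subseteq> span (?V (insert h F))"
  proof
    fix v assume "v \<in> ?V F"
    then obtain l where l: "\<forall>g\<in>F. bracket g v = scale (l g) v" by (simp, metis)
    define W where "W = {w. \<forall>g\<in>F. bracket g w = scale (l g) w}"
    have W: "subspace W"
      by (auto simp: W_def subspace_def bracket_add_right scale_right_distrib bracket_scale_right mult.commute)
    have inv: "bracket h w \<in> W" if "w \<in> W" for w
    proof -
      have "bracket g (bracket h w) = scale (l g) (bracket h w)" if g: "g \<in> F" for g
      proof -
        have "bracket g (bracket h w) = bracket h (bracket g w)"
          using jacobi_left[of g h w] torus_abelian[of g h] g insert.prems by auto
        then show ?thesis using \<open>w \<in> W\<close> g by (simp add: W_def bracket_scale_right)
      qed
      then show ?thesis by (simp add: W_def)
    qed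
    obtain D w where D: "finite D" "\<And>d. d \<in> D \<Longrightarrow> bracket h (w d) = scale d (w d)" "v = (\<Sum>d\<in>D. w d)"
      using diagonalizable_decomp[OF linear_bracket dh] by blast
    have "v \<in> W" using l by (simp add: W_def)
    then have "\<forall>d\<in>D. w d \<in> W"
      using D inv by (intro eigen_components_mem[where f = "bracket h"] linear_bracket W) auto
    then have "w d \<in> ?V (insert h F)" if "d \<in> D" for d
      using that D(2) by (auto simp: W_def)
    then show "v \<in> span (?V (insert h F))"
      unfolding D(3) by (intro span_sum span_base)
  qed
  then have "span (?V F) \<subseteq> span (?V (insert h F))" by (simp add: span_minimal)
  then show ?case using insert by auto
qed

text \<open>As \<open>v\<close> is nonzero, its eigenvalue under each \<open>h\<close> is unique,
  and uniqueness forces it to depend linearly on \<open>h\<close>.\<close>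

lemma weight_vector:
  assumes v: "v \<noteq> 0" and eig: "\<forall>h\<in>H. \<exists>c. bracket h v = scale c v"
  shows "\<exists>\<alpha>\<in>dual_space scale H. v \<in> wspace \<alpha>"
proof -
  obtain c where c: "\<And>h. h \<in> H \<Longrightarrow> bracket h v = scale (c h) v" using eig by metis
  define \<alpha> where "\<alpha> h = (if h \<in> H then c h else 0)" for h
  have "\<alpha> (g + h) = \<alpha> g + \<alpha> h" if "g \<in> H" "h \<in> H" for g h
  proof -
    have "scale (c (g + h)) v = scale (c g + c h) v"
      using that c subspace_H by (metis bracket_add_left scale_left_distrib subspace_add)
    then show ?thesis using v that subspace_H by (simp add: \<alpha>_def subspace_add)
  qed
  moreover have "\<alpha> (scale a h) = a * \<alpha> h" if "h \<in> H" for a h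
  proof -
    have "scale (c (scale a h)) v = scale (a * c h) v"
      using that c subspace_H by (metis bracket_scale_left scale_scale subspace_scale)
    then show ?thesis using v that subspace_H by (simp add: \<alpha>_def subspace_scale)
  qed
  ultimately have "\<alpha> \<in> dual_space scale H" by (simp add: dual_space_def \<alpha>_def)
  moreover have "v \<in> wspace \<alpha>" using c by (simp add: root_space_def \<alpha>_def)
  ultimately show ?thesis by blast
qed

text \<open>An eigenvector for a finite basis of \<open>H\<close> is one for all of
  \<open>H\<close>. The weight 0 is added by hand, because roots are nonzero by definition.\<close>

lemma ex_weight_basis:
  "\<exists>B \<mu>. is_basis scale B \<and> (\<forall>b\<in>B. \<mu> b \<in> insert 0 \<Phi> \<and> b \<in> wspace (\<mu> b))"
proof -
  obtain F where F: "F \<subseteq> H" "independent F" "H \<subseteq> span F"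
    using maximal_independent_subset[of H] by blast
  note finF = independent_finite[OF F(2)]
  obtain B where B: "B \<subseteq> {v. \<forall>h\<in>F. \<exists>c. bracket h v = scale c v}" "is_basis scale B"
    using ex_basis_subset[OF span_simultaneous_eigenvectors[OF finF F(1)]] by blast
  have "\<exists>\<alpha>. \<alpha> \<in> insert 0 \<Phi> \<and> b \<in> wspace \<alpha>" if b: "b \<in> B" for b
  proof -
    have b0: "b \<noteq> 0" using b B(2) dependent_zero by (auto simp: is_basis_def)
    have "\<exists>c. bracket h b = scale c b" if "h \<in> H" for h
    proof -
      have "h \<in> span F" using that F(3) by auto
      then show ?thesis
      proof (induction rule: span_induct_alt)
        case base
        show ?case by (rule exI[of _ 0]) simp
      next
        case (step a g h)
        then obtain c d where "bracket g b = scale c b" "bracket h b = scale d b" using b B(1) by blast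
        then have "bracket (scale a g + h) b = scale (a * c + d) b"
          by (simp add: bracket_add_left bracket_scale_left scale_left_distrib)
        then show ?case by blast
      qed
    qed
    then obtain \<alpha> where "\<alpha> \<in> dual_space scale H" "b \<in> wspace \<alpha>" using weight_vector[OF b0] by blast
    then have "\<alpha> \<in> insert 0 \<Phi>" using b0 by (auto simp: roots_def)
    then show ?thesis using \<open>b \<in> wspace \<alpha>\<close> by blast
  qed
  then show ?thesis using B(2) by metis
qed

text \<open>A central element spans an abelian, hence solvable, ideal.\<close>

lemma center_trivial:
  assumes "\<And>y. bracket z y = 0"
  shows "z = 0"
proof -
  have z: "bracket y z = 0" for y using assms bracket_anti[of y z] by simp
  have br: "bracket y u = 0" if "u \<in> span {z}" for y u
    using that z by (auto simp: span_singleton bracket_scale_right)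
  have "lie_ideal scale bracket (span {z})"
    using br by (auto simp: lie_ideal_def span_zero)
  moreover have "derived_series scale bracket (span {z}) 1 = {0}"
  proof -
    have "{bracket x y |x y. x \<in> span {z} \<and> y \<in> span {z}} \<subseteq> {0}" using br by auto
    then have "span {bracket x y |x y. x \<in> span {z} \<and> y \<in> span {z}} \<subseteq> span {0}"
      by (rule span_mono)
    then show ?thesis
      by (auto simp: lie_product_def span_zero)
  qed
  then have "solvable scale bracket (span {z})" unfolding solvable_def by blast
  ultimately have "span {z} = {0}" using semisimple by (auto simp: semisimple_def)
  then show ?thesis using span_base[of z "{z}"] by auto
qed

text \<open>An element of \<open>H\<close> at which all weights vanish kills a basis, hence is
  central.\<close>

lemma weights_separate:
  assumes B: "is_basis scale B" and w: "\<And>b. b \<in> B \<Longrightarrow> b \<in> wspace (\<mu> b)"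
    and h: "h \<in> H" "\<And>b. b \<in> B \<Longrightarrow> \<mu> b h = 0"
  shows "h = 0"
proof (rule center_trivial)
  fix y
  have "y \<in> span B" using B by (auto simp: is_basis_def)
  then show "bracket h y = 0"
  proof (induction rule: span_induct_alt)
    case (step c b y)
    then show ?case using w[of b] h by (simp add: bracket_add_right bracket_scale_right root_space_def)
  qed simp
qed

lemma roots_separate:
  assumes "h \<in> H" "\<And>\<alpha>. \<alpha> \<in> \<Phi> \<Longrightarrow> \<alpha> h = 0"
  shows "h = 0"
proof -
  obtain B \<mu> where B: "is_basis scale B" "\<forall>b\<in>B. \<mu> b \<in> insert 0 \<Phi> \<and> b \<in> wspace (\<mu> b)"
    using ex_weight_basis by blast
  have "\<mu> b h = 0" if "b \<in> B" for b
    using B(2) that assms(2) by (cases "\<mu> b = 0") auto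
  then show ?thesis using weights_separate[OF B(1) _ assms(1)] B(2) by blast
qed

text \<open>In a weight basis the maps \<open>bracket g\<close> and \<open>bracket h\<close> are
  diagonal. This presents the form on \<open>H\<close> as a Gram matrix of weight values.\<close>

lemma killing_torus:
  assumes B: "is_basis scale B" and w: "\<And>b. b \<in> B \<Longrightarrow> b \<in> wspace (\<mu> b)"
    and h: "g \<in> H" "h \<in> H"
  shows "K g h = (\<Sum>b\<in>B. \<mu> b g * \<mu> b h)"
proof -
  have ind: "independent B" "span B = UNIV" using B by (auto simp: is_basis_def)
  have "(bracket g \<circ> bracket h) b = scale (\<mu> b g * \<mu> b h) b" if "b \<in> B" for b
    using w[OF that] h by (simp add: root_space_def bracket_scale_right mult.commute)
  then have "representation B ((bracket g \<circ> bracket h) b) b = \<mu> b g * \<mu> b h" if "b \<in> B" for b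
    using that ind by (simp add: representation_scale representation_basis del: o_apply)
  then show ?thesis
    unfolding killing_def trace_eq[OF B linear_bracket2] by (rule sum.cong[OF refl])
qed

end

section \<open>Subalgebras with \<open>dim L = 2 dim [L, L]\<close>\<close>

text \<open>A rational Gram matrix of full rank stays nonsingular over an extension field, because a
  kernel vector is mapped to a rational one by every \<open>\<rat>\<close>-linear functional.\<close>

lemma integer_gram_nondegenerate:
  fixes z :: "'b \<Rightarrow> 'i \<Rightarrow> int" and u :: "'i \<Rightarrow> 'k::field_char_0"
  assumes fin: "finite B" "finite J"
    and z: "\<And>w :: 'i \<Rightarrow> rat. (\<And>b. b \<in> B \<Longrightarrow> (\<Sum>i\<in>J. of_int (z b i) * w i) = 0) \<Longrightarrow> \<forall>i\<in>J. w i = 0"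
    and u: "\<And>k. k \<in> J \<Longrightarrow> (\<Sum>i\<in>J. u i * (\<Sum>b\<in>B. of_int (z b i) * of_int (z b k))) = 0"
    and i: "i \<in> J"
  shows "u i = 0"
proof (rule ccontr)
  assume "u i \<noteq> 0"
  interpret Q: vector_space "\<lambda>(r::rat) (x::'k). of_rat r * x"
    by unfold_locales (auto simp: algebra_simps of_rat_add of_rat_mult)
  obtain \<phi> where add: "\<And>a b. \<phi> (a + b) = \<phi> a + \<phi> b" and hom: "\<And>c a. \<phi> (of_rat c * a) = c * \<phi> a"
    and "\<phi> (u i) = 1"
    using Q.linear_functional_nonzero[OF \<open>u i \<noteq> 0\<close>] by blast
  have zero: "\<phi> 0 = 0" using hom[of 0 0] by simp
  have sum: "\<phi> (\<Sum>i\<in>A. f i) = (\<Sum>i\<in>A. \<phi> (f i))" for A and f :: "'i \<Rightarrow> 'k"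
    by (induction A rule: infinite_finite_induct) (auto simp: zero add)
  let ?w = "\<lambda>i. \<phi> (u i)"
  let ?g = "\<lambda>i k. \<Sum>b\<in>B. of_int (z b i) * of_int (z b k) :: rat"
  have w: "(\<Sum>i\<in>J. ?w i * ?g i k) = 0" if k: "k \<in> J" for k
  proof -
    have eq: "\<phi> (u i * (\<Sum>b\<in>B. of_int (z b i) * of_int (z b k))) = ?w i * ?g i k" for i
    proof -
      have "(\<Sum>b\<in>B. of_int (z b i) * of_int (z b k)) = (of_rat (?g i k) :: 'k)"
        by (simp add: of_rat_sum of_rat_mult)
      then show ?thesis by (simp only: mult.commute[of "u i"] hom) simp
    qed
    have "(\<Sum>i\<in>J. ?w i * ?g i k) = \<phi> (\<Sum>i\<in>J. u i * (\<Sum>b\<in>B. of_int (z b i) * of_int (z b k)))"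
      unfolding sum by (rule sum.cong[OF refl], rule eq[symmetric])
    also have "\<dots> = 0" unfolding u[OF k] by (rule zero)
    finally show ?thesis .
  qed
  \<comment> \<open>The quadratic form at the rational vector \<open>?w\<close> is a sum of squares,
    so its vanishing forces each square to vanish.\<close>
  have "(\<Sum>b\<in>B. (\<Sum>i\<in>J. of_int (z b i) * ?w i)\<^sup>2)
      = (\<Sum>b\<in>B. \<Sum>k\<in>J. \<Sum>i\<in>J. ?w k * (?w i * (of_int (z b i) * of_int (z b k))))"
    by (simp add: power2_eq_square sum_product mult_ac)
  also have "\<dots> = (\<Sum>k\<in>J. \<Sum>b\<in>B. \<Sum>i\<in>J. ?w k * (?w i * (of_int (z b i) * of_int (z b k))))"
    by (rule sum.swap)
  also have "\<dots> = (\<Sum>k\<in>J. ?w k * (\<Sum>i\<in>J. ?w i * ?g i k))"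
    by (rule sum.cong[OF refl], subst sum.swap) (simp only: sum_distrib_left)
  also have "\<dots> = 0" using w by simp
  finally have "\<forall>b\<in>B. (\<Sum>i\<in>J. of_int (z b i) * ?w i)\<^sup>2 = 0"
    using fin by (subst (asm) sum_nonneg_eq_0_iff) auto
  then have "\<forall>i\<in>J. ?w i = 0" by (intro z) auto
  then show False using \<open>\<phi> (u i) = 1\<close> i by auto
qed

text \<open>In the application the index set \<open>I\<close> is the set of roots of the subalgebra.\<close>

locale split_pairs = fd_lie_algebra scale bracket
  for scale :: "'k::field_char_0 \<Rightarrow> 'a::ab_group_add \<Rightarrow> 'a" and bracket :: "'a \<Rightarrow> 'a \<Rightarrow> 'a" +
  fixes I :: "'i set" and e x :: "'i \<Rightarrow> 'a"
  assumes finite_I: "finite I"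
    and br_ee: "i \<in> I \<Longrightarrow> j \<in> I \<Longrightarrow> bracket (e i) (e j) = 0"
    and br_xx: "i \<in> I \<Longrightarrow> j \<in> I \<Longrightarrow> bracket (x i) (x j) = 0"
    and br_ex: "i \<in> I \<Longrightarrow> j \<in> I \<Longrightarrow> bracket (e i) (x j) = (if i = j then x j else 0)"
    and x_nonzero: "i \<in> I \<Longrightarrow> x i \<noteq> 0"
    and gram: "J \<subseteq> I \<Longrightarrow> (\<And>k. k \<in> J \<Longrightarrow> (\<Sum>i\<in>J. u i * killing scale bracket (e i) (e k)) = 0) \<Longrightarrow>
      i \<in> J \<Longrightarrow> u i = 0"

context torus_algebra
begin

lemma int_span_vanish:
  fixes w :: 'a
  assumes "\<alpha> \<in> int_span \<Psi>" "\<And>\<beta>. \<beta> \<in> \<Psi> \<Longrightarrow> \<beta> w = 0"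
  shows "\<alpha> w = (0::'k)"
proof -
  interpret Z: module "\<lambda>(n::int) (\<alpha>::'a \<Rightarrow> 'k) x. of_int n * \<alpha> x"
    by unfold_locales (auto simp: fun_eq_iff algebra_simps)
  show ?thesis
    using assms(1) unfolding int_span_def
    by (induction rule: Z.span_induct_alt) (use assms(2) in auto)
qed

text \<open>The dual vectors take the values 0 and 1 on generators of the root lattice; this makes
  them integral at every root.\<close>

lemma int_span_integral:
  fixes w :: 'a
  assumes "\<alpha> \<in> int_span \<Psi>" "\<And>\<beta>. \<beta> \<in> \<Psi> \<Longrightarrow> \<beta> w \<in> \<int>"
  shows "\<alpha> w \<in> (\<int> :: 'k set)"
proof -
  interpret Z: module "\<lambda>(n::int) (\<alpha>::'a \<Rightarrow> 'k) x. of_int n * \<alpha> x"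
    by unfold_locales (auto simp: fun_eq_iff algebra_simps)
  show ?thesis
    using assms(1) unfolding int_span_def
    by (induction rule: Z.span_induct_alt) (use assms(2) in auto)
qed

lemma int_span_superset: "(\<Psi> :: ('a \<Rightarrow> 'k) set) \<subseteq> int_span \<Psi>"
proof -
  interpret Z: module "\<lambda>(n::int) (\<alpha>::'a \<Rightarrow> 'k) x. of_int n * \<alpha> x"
    by unfold_locales (auto simp: fun_eq_iff algebra_simps)
  show ?thesis unfolding int_span_def by (rule Z.span_superset)
qed

text \<open>The weights of a weight basis lie in the lattice spanned by \<open>I\<close>, so their
  values \<open>z\<close> at the \<open>e i\<close> are integers and the Gram matrix is built from
  \<open>z\<close>. A rational relation among the columns of \<open>z\<close> gives an element
  \<open>g\<close> of \<open>H\<close> at which all weights vanish; then \<open>g = 0\<close>, and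
  evaluating the functionals in \<open>J\<close> at \<open>g\<close> returns the
  coefficients.\<close>

lemma gram_of_dual_family:
  assumes fin: "finite I" and int: "int_span I = int_span \<Phi>" and eH: "\<And>i. i \<in> I \<Longrightarrow> e i \<in> H"
    and dual: "\<And>\<alpha> \<beta>. \<alpha> \<in> I \<Longrightarrow> \<beta> \<in> I \<Longrightarrow> \<alpha> (e \<beta>) = (if \<alpha> = \<beta> then 1 else 0)" and I: "I \<subseteq> \<Phi>"
    and J: "J \<subseteq> I" and u: "\<And>k. k \<in> J \<Longrightarrow> (\<Sum>i\<in>J. u i * K (e i) (e k)) = 0" and i: "i \<in> J"
  shows "u i = 0"
proof -
  obtain B \<mu> where B: "is_basis scale B" and \<mu>: "\<forall>b\<in>B. \<mu> b \<in> insert 0 \<Phi> \<and> b \<in> wspace (\<mu> b)"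
    using ex_weight_basis by blast
  have finJ: "finite J" using J fin finite_subset by blast
  have "\<exists>z. \<mu> b (e i) = of_int z" if "b \<in> B" "i \<in> J" for b i
  proof (cases "\<mu> b = 0")
    case True
    then show ?thesis by (intro exI[of _ 0]) simp
  next
    case False
    then have "\<mu> b \<in> int_span I" using \<mu> that int int_span_superset by auto
    then have "\<mu> b (e i) \<in> \<int>"
      by (rule int_span_integral) (use that(2) J in \<open>auto simp: dual\<close>)
    then show ?thesis by (auto elim: Ints_cases)
  qed
  then obtain z where z: "\<And>b i. b \<in> B \<Longrightarrow> i \<in> J \<Longrightarrow> \<mu> b (e i) = of_int (z b i)" by metis
  show ?thesis
  proof (rule integer_gram_nondegenerate[OF is_basis_finite[OF B] finJ _ _ i])
    fix w :: "('a \<Rightarrow> 'k) \<Rightarrow> rat"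
    assume w: "\<And>b. b \<in> B \<Longrightarrow> (\<Sum>i\<in>J. of_int (z b i) * w i) = 0"
    define g where "g = (\<Sum>i\<in>J. scale (of_rat (w i)) (e i))"
    have gH: "g \<in> H"
      unfolding g_def using eH J by (intro subspace_sum[OF subspace_H] subspace_scale[OF subspace_H]) auto
    have lin: "\<alpha> g = (\<Sum>i\<in>J. of_rat (w i) * \<alpha> (e i))" if \<alpha>: "\<alpha> \<in> insert 0 \<Phi>" for \<alpha>
    proof -
      have d: "\<alpha> \<in> dual_space scale H" using \<alpha> by (auto simp: roots_def dual_space_def)
      then have \<alpha>0: "\<alpha> 0 = 0" using subspace_0[OF subspace_H] unfolding dual_space_def
        by (metis (mono_tags, lifting) add_cancel_right_left mem_Collect_eq add_0)
      show ?thesis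
        unfolding g_def using finJ J
      proof (induction J rule: finite_induct)
        case (insert i J)
        have "(\<Sum>i\<in>J. scale (of_rat (w i)) (e i)) \<in> H"
          using eH insert.prems
          by (intro subspace_sum[OF subspace_H] subspace_scale[OF subspace_H]) auto
        moreover have "e i \<in> H" "scale (of_rat (w i)) (e i) \<in> H"
          using eH insert.prems subspace_scale[OF subspace_H] by auto
        ultimately show ?case using insert d by (simp add: dual_space_def)
      qed (simp add: \<alpha>0)
    qed
    have "g = 0"
    proof (rule weights_separate[OF B _ gH])
      fix b assume b: "b \<in> B"
      then show "b \<in> wspace (\<mu> b)" using \<mu> by blast
      have "\<mu> b g = (\<Sum>i\<in>J. of_rat (w i) * of_int (z b i))"
        using lin[of "\<mu> b"] b \<mu> z by simp
      also have "\<dots> = of_rat (\<Sum>i\<in>J. of_int (z b i) * w i)"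
        by (simp add: of_rat_sum of_rat_mult mult.commute)
      finally show "\<mu> b g = 0" using w[OF b] by simp
    qed
    have "of_rat (w j) = (0::'k)" if j: "j \<in> J" for j
    proof -
      have "j g = (\<Sum>i\<in>J. of_rat (w i) * j (e i))" using lin j J I by blast
      also have "\<dots> = of_rat (w j)"
        using j J finJ by (simp add: dual subset_iff if_distrib[of "\<lambda>t. _ * t"] cong: if_cong)
      also have "j g = j (scale 0 g)" by (simp add: \<open>g = 0\<close>)
      also have "\<dots> = 0" using gH j J I by (auto simp: roots_def dual_space_def simp del: scale_zero_left)
      finally show ?thesis by simp
    qed
    then show "\<forall>i\<in>J. w i = 0" by simp
  next
    fix k assume k: "k \<in> J"
    have "K (e i) (e k) = (\<Sum>b\<in>B. of_int (z b i) * of_int (z b k))" if "i \<in> J" for i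
      using \<mu> that k z eH J by (subst killing_torus[OF B, of \<mu>]) auto
    then show "(\<Sum>i\<in>J. u i * (\<Sum>b\<in>B. of_int (z b i) * of_int (z b k))) = 0"
      using u[OF k] by simp
  qed
qed

text \<open>The roots of \<open>L\<close> span the dual of \<open>H\<close>, so there are at least \<open>dim H\<close> of them; as all their
  root spaces lie in the derived algebra, the dimension hypothesis leaves no room for more.
  The sum \<open>E\<close> of the vectors dual to the roots acts as the identity on the derived algebra, and
  as multiplication by \<open>2\<close> on a bracket of two root vectors, which therefore vanishes.\<close>

lemma split_structure:
  assumes Q: "Q_graded scale bracket H L" and dimL: "dim L = 2 * dim (lie_product scale bracket L L)"
  obtains I :: "('a \<Rightarrow> 'k) set" and e x
  where "split_pairs scale bracket I e x" "H = span (e ` I)"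
    "lie_product scale bracket L L = span (x ` I)" "L = span (e ` I \<union> x ` I)"
proof -
  obtain \<Psi> where sub: "lie_subalgebra scale bracket L" and \<Psi>: "\<Psi> \<subseteq> \<Phi>"
    and L: "L = span (H \<union> (\<Union>\<alpha>\<in>\<Psi>. wspace \<alpha>))" and int: "int_span \<Psi> = int_span \<Phi>"
    using Q by (auto simp: Q_graded_def)
  have dual_\<Psi>: "\<alpha> \<in> dual_space scale H" if "\<alpha> \<in> \<Psi>" for \<alpha> using that \<Psi> by (auto simp: roots_def)
  have sep: "w = 0" if "w \<in> H" "\<And>\<alpha>. \<alpha> \<in> \<Psi> \<Longrightarrow> \<alpha> w = 0" for w
    by (rule roots_separate[OF that(1)], rule int_span_vanish[of _ \<Psi>])
      (use that(2) int int_span_superset in auto)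
  obtain I e where fin: "finite I" and I: "I \<subseteq> \<Psi>"
    and dual: "\<And>\<alpha> \<beta>. \<alpha> \<in> I \<Longrightarrow> \<beta> \<in> I \<Longrightarrow> \<alpha> (e \<beta>) = (if \<alpha> = \<beta> then 1 else 0)"
    and H: "H = span (e ` I)" and card: "card I = dim H"
    by (rule ex_dual_family[OF subspace_H, of \<Psi>]) (use dual_\<Psi> sep in \<open>auto simp: dual_space_def\<close>)
  have eH: "e i \<in> H" if "i \<in> I" for i using that by (simp add: H span_base)
  have "\<exists>x. x \<in> wspace \<alpha> \<and> x \<noteq> 0" if "\<alpha> \<in> I" for \<alpha>
  proof -
    have "wspace \<alpha> \<noteq> {0}" using that I \<Psi> by (auto simp: roots_def)
    moreover have "0 \<in> wspace \<alpha>" by (simp add: root_space_def)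
    ultimately show ?thesis by blast
  qed
  then obtain x where x: "\<And>\<alpha>. \<alpha> \<in> I \<Longrightarrow> x \<alpha> \<in> wspace \<alpha>" "\<And>\<alpha>. \<alpha> \<in> I \<Longrightarrow> x \<alpha> \<noteq> 0" by metis
  have br_ex: "bracket (e i) (x j) = (if i = j then x j else 0)" if "i \<in> I" "j \<in> I" for i j
    using x(1)[OF that(2)] eH[OF that(1)] dual[OF that(2,1)] by (auto simp: root_space_def)
  have br_e_sum: "bracket (e i) (\<Sum>j\<in>I. scale (c j) (x j)) = scale (c i) (x i)" if "i \<in> I" for c i
    using that fin
    by (simp add: bracket_sum_right bracket_scale_right br_ex if_distrib[of "scale _"] cong: if_cong)
  have "c i = 0" if "(\<Sum>j\<in>I. scale (c j) (x j)) = 0" "i \<in> I" for c i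
    using br_e_sum[OF that(2), of c] that x(2) by simp
  then have indep: "inj_on x I" "independent (x ` I)"
    using independent_family[OF fin, of x] by blast+
  define N where "N = span (\<Union>\<alpha>\<in>\<Psi>. wspace \<alpha>)"
  define P where "P = lie_product scale bracket L L"
  obtain B where B: "is_basis scale B" using ex_is_basis by blast
  interpret F: finite_dimensional_vector_space scale B
    using B is_basis_finite[OF B] by unfold_locales (auto simp: is_basis_def)
  have HL: "H \<subseteq> L" and wL: "\<And>\<alpha>. \<alpha> \<in> \<Psi> \<Longrightarrow> wspace \<alpha> \<subseteq> L"
    unfolding L by (auto intro: span_base)
  have "wspace \<alpha> \<subseteq> P" if \<alpha>: "\<alpha> \<in> \<Psi>" for \<alpha>
  proof
    fix v assume v: "v \<in> wspace \<alpha>"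
    have "\<alpha> \<noteq> 0" using \<alpha> \<Psi> by (auto simp: roots_def)
    then obtain h where h: "\<alpha> h \<noteq> 0" by (auto simp: fun_eq_iff)
    then have hH: "h \<in> H" using dual_\<Psi>[OF \<alpha>] by (auto simp: dual_space_def)
    have "bracket (scale (inverse (\<alpha> h)) h) v = v"
      using v h hH by (simp add: root_space_def bracket_scale_left)
    moreover have "scale (inverse (\<alpha> h)) h \<in> L"
      using hH HL subspace_scale[OF subspace_H] by auto
    ultimately show "v \<in> P"
      unfolding P_def lie_product_def using v wL[OF \<alpha>]
      by (intro span_base CollectI exI[of _ "scale (inverse (\<alpha> h)) h"] exI[of _ v]) auto
  qed
  then have NP: "N \<subseteq> P"
    unfolding N_def P_def lie_product_def by (intro span_minimal subspace_span) auto
  have xN: "x ` I \<subseteq> N" using x(1) I by (auto simp: N_def intro: span_base)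
  have "dim L \<le> dim H + dim N"
  proof -
    have "L = {a + b |a b. a \<in> H \<and> b \<in> N}"
      unfolding L N_def span_Un span_eq_iff[THEN iffD2, OF subspace_H] ..
    then show ?thesis
      using F.dim_sums_Int[OF subspace_H, of N] by (simp add: N_def subspace_span)
  qed
  moreover have "card I \<le> dim N"
    using F.independent_card_le_dim[OF xN indep(2)] card_image[OF indep(1)] by simp
  moreover have "dim N \<le> dim P" using NP by (rule F.dim_subset)
  \<comment> \<open>From \<open>2 * dim P \<le> card I + dim N\<close> and
    \<open>card I \<le> dim N \<le> dim P\<close>, equality holds throughout.\<close>
  ultimately have dims: "dim N = card I" "dim P = card I"
    using dimL card unfolding P_def[symmetric] by auto
  have NPeq: "N = P"
    using F.subspace_dim_equal[of N P] NP dims by (simp add: N_def P_def lie_product_def subspace_span)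
  have "dim (span (x ` I)) = card I"
    using dim_span_eq_card_independent[OF indep(2)] card_image[OF indep(1)] by simp
  moreover have "span (x ` I) \<subseteq> N" using xN by (simp add: N_def span_minimal subspace_span)
  ultimately have xN: "span (x ` I) = N"
    using F.subspace_dim_equal[of "span (x ` I)" N] dims by (simp add: N_def subspace_span)
  \<comment> \<open>A root vector for \<open>\<beta>\<close> is a combination of the
    \<open>x j\<close>. Bracketing with \<open>e m\<close> isolates the term of \<open>x m\<close>;
    when that term is nonzero, the vector is proportional to \<open>x m\<close>, so the two weights
    coincide.\<close>
  have "\<Psi> \<subseteq> I"
  proof
    fix \<beta> assume \<beta>: "\<beta> \<in> \<Psi>"
    then have "wspace \<beta> \<noteq> {0}" using \<Psi> by (auto simp: roots_def)
    moreover have "0 \<in> wspace \<beta>" by (simp add: root_space_def)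
    ultimately obtain v where v: "v \<in> wspace \<beta>" "v \<noteq> 0" by blast
    then have "v \<in> span (x ` I)" unfolding xN N_def using \<beta> by (auto intro: span_base)
    then obtain c where c: "v = (\<Sum>j\<in>I. scale (c j) (x j))" using span_image_sum[OF fin] by blast
    then have "\<exists>m\<in>I. scale (c m) (x m) \<noteq> 0"
      using v(2) by (metis (no_types, lifting) sum.neutral)
    then obtain m where m: "m \<in> I" "scale (c m) (x m) \<noteq> 0" by blast
    have ev: "scale (\<beta> (e m)) v = scale (c m) (x m)"
      using v(1) eH[OF m(1)] br_e_sum[OF m(1), of c] by (simp add: root_space_def c)
    then have b0: "\<beta> (e m) \<noteq> 0" using m(2) by auto
    have vx: "v = scale (inverse (\<beta> (e m)) * c m) (x m)"
      using b0 by (simp add: ev[symmetric] scale_scale[symmetric] del: scale_scale) simp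
    have "\<beta> h = m h" if h: "h \<in> H" for h
    proof -
      have "bracket h v = scale (m h) v"
        using x(1)[OF m(1)] h by (simp add: vx bracket_scale_right root_space_def mult.commute)
      then have "scale (\<beta> h) v = scale (m h) v" using v(1) h by (simp add: root_space_def)
      then show ?thesis using v(2) by simp
    qed
    \<comment> \<open>Functionals on \<open>H\<close> are extended by 0, so equality as functions
      also concerns points outside \<open>H\<close>.\<close>
    moreover have "\<beta> h = m h" if "h \<notin> H" for h
      using that dual_\<Psi>[OF \<beta>] dual_\<Psi>[of m] m(1) I by (auto simp: dual_space_def)
    ultimately have "\<beta> = m" by blast
    then show "\<beta> \<in> I" using m(1) by simp
  qed
  then have \<Psi>I: "\<Psi> = I" using I by blast
  define E where "E = (\<Sum>i\<in>I. e i)"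
  have Ex: "bracket E (x j) = x j" if "j \<in> I" for j
    using that fin by (simp add: E_def bracket_sum_left br_ex cong: if_cong)
  have EN: "bracket E v = v" if "v \<in> span (x ` I)" for v
    using that by (induction rule: span_induct_alt) (auto simp: bracket_add_right bracket_scale_right Ex)
  have br_xx: "bracket (x i) (x j) = 0" if "i \<in> I" "j \<in> I" for i j
  proof -
    let ?v = "bracket (x i) (x j)"
    have "x i \<in> L" "x j \<in> L" using that x(1) wL I by blast+
    then have "?v \<in> P" unfolding P_def lie_product_def by (intro span_base) blast
    then have "bracket E ?v = ?v" using EN xN NPeq by simp
    moreover have "bracket E ?v = bracket (bracket E (x i)) (x j) + bracket (x i) (bracket E (x j))"
      using jacobi_left[of E "x i" "x j"] by simp
    ultimately have "?v = ?v + ?v" using that Ex by simp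
    then show ?thesis by simp
  qed
  have "split_pairs scale bracket I e x"
  proof unfold_locales
    show "u i = 0" if "J \<subseteq> I" "\<And>k. k \<in> J \<Longrightarrow> (\<Sum>i\<in>J. u i * K (e i) (e k)) = 0" "i \<in> J" for J u i
      by (rule gram_of_dual_family[OF fin _ eH dual _ that]) (use int \<Psi>I \<Psi> in auto)
  qed (use fin br_xx br_ex x(2) torus_abelian eH in auto)
  moreover have "L = span (e ` I \<union> x ` I)"
    unfolding L span_Un using xN H subspace_H by (simp add: N_def span_span)
  ultimately show thesis
    using that H xN NPeq unfolding P_def by blast
qed

end

section \<open>The bracket of an affinization\<close>

abbreviation cf :: "('k, 'a::zero) affine \<Rightarrow> int \<Rightarrow> 'a" where
  "cf u \<equiv> Poly_Mapping.lookup (fst u)"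

lemma affine_eqI:
  fixes u v :: "('k, 'a::zero) affine"
  shows "(\<And>n. cf u n = cf v n) \<Longrightarrow> snd u = snd v \<Longrightarrow> u = v"
  by (simp add: poly_mapping_eqI prod_eq_iff)

declare lookup_add [simp]

lemma cf_loop: "cf (loop v n) m = (if m = n then v else 0)"
  by (simp add: loop_def lookup_single when_def)

lemma snd_loop [simp]: "snd (loop v n) = 0"
  by (simp add: loop_def)

lemma cf_central_K [simp]: "cf central_K n = 0" and snd_central_K [simp]: "snd central_K = 1"
  by (simp_all add: central_K_def)

lemma mem_affinization: "u \<in> affinization A \<longleftrightarrow> (\<forall>n. cf u n \<in> A)"
  by (auto simp: affinization_def case_prod_beta)

lemma loop_zero [simp]: "loop 0 n = 0"
  by (simp add: loop_def zero_prod_def)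

text \<open>Laurent polynomials over a domain have no zero divisors: in the sum of the top degrees
  only the product of the leading coefficients survives.\<close>

lemma convolution_nonzero:
  fixes f g :: "int \<Rightarrow> 'k::idom"
  assumes f: "finite {n. f n \<noteq> 0}" "f a \<noteq> 0" and g: "finite S" "{n. g n \<noteq> 0} \<subseteq> S" "g b \<noteq> 0"
  shows "\<exists>r. (\<Sum>m\<in>S. g m * f (r - m)) \<noteq> 0"
proof -
  have fing: "finite {n. g n \<noteq> 0}" using g finite_subset by blast
  define a' b' where "a' = Max {n. f n \<noteq> 0}" and "b' = Max {n. g n \<noteq> 0}"
  have a': "f a' \<noteq> 0" using Max_in[OF f(1)] f(2) by (auto simp: a'_def)
  have b': "g b' \<noteq> 0" using Max_in[OF fing] g(3) by (auto simp: b'_def)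
  have "(\<Sum>m\<in>S. g m * f (a' + b' - m)) = (\<Sum>m\<in>{b'}. g m * f (a' + b' - m))"
  proof (rule sum.mono_neutral_right[OF g(1)])
    show "\<forall>m\<in>S - {b'}. g m * f (a' + b' - m) = 0"
    proof (rule ballI, rule ccontr)
      fix m assume m: "m \<in> S - {b'}" "g m * f (a' + b' - m) \<noteq> 0"
      then have "m \<le> b'" "a' + b' - m \<le> a'"
        unfolding a'_def b'_def using f(1) fing by (auto intro!: Max_ge)
      then show False using m by auto
    qed
  qed (use b' g in auto)
  then show ?thesis using a' b' by (intro exI[of _ "a' + b'"]) simp
qed

context fd_lie_algebra
begin

abbreviation "AS \<equiv> aff_scale scale"
abbreviation "BR \<equiv> aff_bracket scale bracket"

lemma cf_AS [simp]: "cf (AS c u) n = scale c (cf u n)"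
  by (auto simp: aff_scale_def Poly_Mapping.map.rep_eq when_def)

lemma snd_AS [simp]: "snd (AS c u) = c * snd u"
  by (simp add: aff_scale_def)

text \<open>Replacing the support of \<open>u\<close> by any finite \<open>S\<close> containing it
  lets brackets of elements with different supports be compared term by term.\<close>

lemma cf_BR:
  assumes "finite S" "\<And>m. cf u m \<noteq> 0 \<Longrightarrow> m \<in> S"
  shows "cf (BR u v) n = (\<Sum>m\<in>S. bracket (cf u m) (cf v (n - m)))"
proof -
  have "cf (BR u v) n = (\<Sum>m\<in>Poly_Mapping.keys (fst u). \<Sum>k\<in>Poly_Mapping.keys (fst v).
      if k = n - m then bracket (cf u m) (cf v k) else 0)"
    unfolding aff_bracket_def Let_def fst_conv lookup_sum lookup_single when_def
    by (simp only: eq_diff_eq add.commute)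
  also have "\<dots> = (\<Sum>m\<in>Poly_Mapping.keys (fst u). bracket (cf u m) (cf v (n - m)))"
    by (auto simp: in_keys_iff intro!: sum.cong)
  also have "\<dots> = (\<Sum>m\<in>S. bracket (cf u m) (cf v (n - m)))"
    using assms by (intro sum.mono_neutral_left) (auto simp: in_keys_iff)
  finally show ?thesis .
qed

lemma snd_BR:
  assumes "finite S" "\<And>m. cf u m \<noteq> 0 \<Longrightarrow> m \<in> S"
  shows "snd (BR u v) = (\<Sum>m\<in>S. of_int m * K (cf u m) (cf v (- m)))"
proof -
  have "snd (BR u v) = (\<Sum>m\<in>Poly_Mapping.keys (fst u). \<Sum>k\<in>Poly_Mapping.keys (fst v).
      if k = - m then of_int m * K (cf u m) (cf v k) else 0)"
    unfolding aff_bracket_def Let_def snd_conv eq_neg_iff_add_eq_0 by (simp only: add.commute)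
  also have "\<dots> = (\<Sum>m\<in>Poly_Mapping.keys (fst u). of_int m * K (cf u m) (cf v (- m)))"
    by (auto simp: in_keys_iff intro!: sum.cong)
  also have "\<dots> = (\<Sum>m\<in>S. of_int m * K (cf u m) (cf v (- m)))"
    using assms by (intro sum.mono_neutral_left) (auto simp: in_keys_iff)
  finally show ?thesis .
qed

lemma cf_BR_supp: "cf (BR u v) n = (\<Sum>m\<in>{n. cf u n \<noteq> 0}. bracket (cf u m) (cf v (n - m)))"
  by (rule cf_BR) auto

lemma snd_BR_supp: "snd (BR u v) = (\<Sum>m\<in>{n. cf u n \<noteq> 0}. of_int m * K (cf u m) (cf v (- m)))"
  by (rule snd_BR) auto

lemma BR_add_left: "BR (u + v) w = BR u w + BR v w"
proof -
  let ?S = "{n. cf u n \<noteq> 0} \<union> {n. cf v n \<noteq> 0}"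
  have fin: "finite ?S" by simp
  have S: "m \<in> ?S" if "cf (u + v) m \<noteq> 0 \<or> cf u m \<noteq> 0 \<or> cf v m \<noteq> 0" for m using that by auto
  have c: "cf (BR z w) n = (\<Sum>m\<in>?S. bracket (cf z m) (cf w (n - m)))"
    if "z \<in> {u + v, u, v}" for z n
    by (rule cf_BR[OF fin S]) (use that in auto)
  have s: "snd (BR z w) = (\<Sum>m\<in>?S. of_int m * K (cf z m) (cf w (- m)))"
    if "z \<in> {u + v, u, v}" for z
    by (rule snd_BR[OF fin S]) (use that in auto)
  show ?thesis
    by (rule affine_eqI)
      (simp_all add: c s bracket_add_left killing_add_left sum.distrib distrib_left)
qed

lemma BR_add_right: "BR u (v + w) = BR u v + BR u w"
  by (rule affine_eqI)
    (simp_all add: cf_BR_supp snd_BR_supp bracket_add_right killing_add_right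
      sum.distrib algebra_simps)

lemma BR_scale_right: "BR u (AS c v) = AS c (BR u v)"
  by (rule affine_eqI)
    (simp_all add: cf_BR_supp snd_BR_supp bracket_scale_right killing_scale_right
      scale_sum_right sum_distrib_left mult_ac)

lemma BR_zero_left [simp]: "BR 0 u = 0"
  using BR_add_left[of 0 0 u] by simp

lemma BR_zero_right [simp]: "BR u 0 = 0"
  using BR_add_right[of u 0 0] by simp

lemma BR_minus_left: "BR (- u) v = - BR u v"
  using BR_add_left[of u "- u" v] by (simp add: eq_neg_iff_add_eq_0 add.commute)

lemma BR_central_left: "(\<And>n. cf u n = 0) \<Longrightarrow> BR u v = 0"
  by (rule affine_eqI) (simp_all add: cf_BR_supp snd_BR_supp)

lemma BR_central_right: "(\<And>n. cf v n = 0) \<Longrightarrow> BR u v = 0"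
  by (rule affine_eqI) (simp_all add: cf_BR_supp snd_BR_supp)

lemma cf_BR_loop_left: "cf (BR (loop v n) w) m = bracket v (cf w (m - n))"
  by (subst cf_BR[where S = "{n}"]) (auto simp: cf_loop split: if_splits)

lemma snd_BR_loop_left: "snd (BR (loop v n) w) = of_int n * K v (cf w (- n))"
  by (subst snd_BR[where S = "{n}"]) (auto simp: cf_loop split: if_splits)

lemma cf_BR_loop_right: "cf (BR u (loop v n)) m = bracket (cf u (m - n)) v"
proof -
  have "cf (BR u (loop v n)) m
      = (\<Sum>k\<in>{k. cf u k \<noteq> 0}. if k = m - n then bracket (cf u k) v else 0)"
    unfolding cf_BR_supp by (rule sum.cong[OF refl]) (auto simp: cf_loop)
  then show ?thesis by auto
qed

lemma snd_BR_loop_right: "snd (BR u (loop v n)) = - of_int n * K (cf u (- n)) v"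
proof -
  have "snd (BR u (loop v n))
      = (\<Sum>k\<in>{k. cf u k \<noteq> 0}. if k = - n then of_int k * K (cf u k) v else 0)"
    unfolding snd_BR_supp by (rule sum.cong[OF refl]) (auto simp: cf_loop)
  then show ?thesis by auto
qed

lemma affine_decomp: "u = (\<Sum>n\<in>{n. cf u n \<noteq> 0}. loop (cf u n) n) + AS (snd u) central_K"
proof (rule affine_eqI)
  have s: "fst (\<Sum>n\<in>S. loop (f n) n) = (\<Sum>n\<in>S. Poly_Mapping.single n (f n))"
    "snd (\<Sum>n\<in>S. loop (f n) n) = (0::'k)" for S and f :: "int \<Rightarrow> 'a"
    by (induction S rule: infinite_finite_induct) (auto simp: loop_def)
  show "cf u m = cf ((\<Sum>n\<in>{n. cf u n \<noteq> 0}. loop (cf u n) n) + AS (snd u) central_K) m" for m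
    by (simp add: s lookup_sum lookup_single when_def)
  show "snd u = snd ((\<Sum>n\<in>{n. cf u n \<noteq> 0}. loop (cf u n) n) + AS (snd u) central_K)"
    unfolding snd_add s by simp
qed

lemma mem_endomorphismsD:
  assumes "E \<in> endomorphisms AS M"
  shows "\<And>u. u \<in> M \<Longrightarrow> E u \<in> M" "\<And>u v. u \<in> M \<Longrightarrow> v \<in> M \<Longrightarrow> E (u + v) = E u + E v"
    "\<And>c u. u \<in> M \<Longrightarrow> E (AS c u) = AS c (E u)" "\<And>u. u \<notin> M \<Longrightarrow> E u = 0"
  using assms by (auto simp: endomorphisms_def)

lemma endomorphism_eqI:
  assumes G: "L = span G"
    and E: "E \<in> endomorphisms AS (affinization L)" and F: "F \<in> endomorphisms AS (affinization L)"
    and loop: "\<And>g n. g \<in> G \<Longrightarrow> E (loop g n) = F (loop g n)" and K: "E central_K = F central_K"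
  shows "E = F"
proof
  fix u
  let ?M = "affinization L :: ('k, 'a) affine set"
  have L: "subspace L" by (simp add: G)
  have l: "loop v n \<in> ?M" if "v \<in> L" for v n
    using that subspace_0[OF L] by (auto simp: mem_affinization cf_loop)
  have M: "u + v \<in> ?M" if "u \<in> ?M" "v \<in> ?M" for u v
    using that by (auto simp: mem_affinization intro: subspace_add[OF L])
  have KM: "central_K \<in> ?M" "AS c central_K \<in> ?M" "(0 :: ('k, 'a) affine) \<in> ?M" for c
    using subspace_0[OF L] by (auto simp: mem_affinization)
  have cM: "AS c u \<in> ?M" if "u \<in> ?M" for c u
    using that by (auto simp: mem_affinization intro: subspace_scale[OF L])
  have zero: "E 0 = 0" "F 0 = 0"
    using mem_endomorphismsD(2)[OF E KM(3) KM(3)] mem_endomorphismsD(2)[OF F KM(3) KM(3)] by auto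
  \<comment> \<open>Membership in \<open>?M\<close> is carried along, because \<open>E\<close> and
    \<open>F\<close> are additive only there.\<close>
  have EF: "loop v n \<in> ?M \<and> E (loop v n) = F (loop v n)" if "v \<in> L" for v n
    using that unfolding G
  proof (induction rule: span_induct_alt)
    case base
    show ?case using zero KM(3) by (simp add: G)
  next
    case (step c g v)
    have eq: "loop (scale c g + v) n = AS c (loop g n) + loop v n"
      by (rule affine_eqI) (auto simp: cf_loop)
    have mem: "loop g n \<in> ?M" "loop v n \<in> ?M" "AS c (loop g n) \<in> ?M"
      using step l[of g n] cM by (auto simp: G span_base)
    then show ?case
      unfolding eq G[symmetric] using step loop M mem_endomorphismsD[OF E] mem_endomorphismsD[OF F]
      by simp
  qed
  show "E u = F u"
  proof (cases "u \<in> ?M")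
    case True
    have "(\<Sum>n\<in>S. loop (cf u n) n) \<in> ?M \<and>
        E (\<Sum>n\<in>S. loop (cf u n) n) = F (\<Sum>n\<in>S. loop (cf u n) n)" for S
    proof (induction S rule: infinite_finite_induct)
      case (insert n S)
      have "cf u n \<in> L" using True by (auto simp: mem_affinization)
      then show ?case using insert EF l M mem_endomorphismsD(2)[OF E] mem_endomorphismsD(2)[OF F]
        by simp
    qed (use zero KM in auto)
    then show ?thesis
      using KM K mem_endomorphismsD[OF E] mem_endomorphismsD[OF F]
      by (subst (1 2) affine_decomp) simp
  qed (simp add: mem_endomorphismsD(4)[OF E] mem_endomorphismsD(4)[OF F])
qed

end

section \<open>Almost inner derivations\<close>

context split_pairs
begin

section \<open>Coordinates on the sum of the two-dimensional algebras\<close>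

abbreviation "L \<equiv> span (e ` I \<union> x ` I)"
abbreviation "M \<equiv> affinization L :: ('k, 'a) affine set"

text \<open>Any functional with value 1 at \<open>x i\<close> serves: brackets of \<open>L\<close>
  with \<open>x i\<close> or \<open>e i\<close> are multiples of \<open>x i\<close>, and
  \<open>phi i\<close> extracts the factor.\<close>

definition phi :: "'i \<Rightarrow> 'a \<Rightarrow> 'k" where
  "phi i = (SOME f. (\<forall>u v. f (u + v) = f u + f v) \<and> (\<forall>c u. f (scale c u) = c * f u) \<and> f (x i) = 1)"

text \<open>On \<open>L\<close>, \<open>p i\<close> and \<open>q i\<close> are the coordinates with respect to \<open>e i\<close> and \<open>x i\<close>; they are linear
  on the whole type.\<close>

definition p :: "'i \<Rightarrow> 'a \<Rightarrow> 'k" where "p i v = phi i (bracket v (x i))"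
definition q :: "'i \<Rightarrow> 'a \<Rightarrow> 'k" where "q i v = phi i (bracket (e i) v)"

lemma phi:
  assumes "i \<in> I"
  shows phi_add: "phi i (u + v) = phi i u + phi i v" and phi_scale: "phi i (scale c u) = c * phi i u"
    and phi_x: "phi i (x i) = 1"
proof -
  have *: "(\<forall>u v. phi i (u + v) = phi i u + phi i v) \<and> (\<forall>c u. phi i (scale c u) = c * phi i u)
      \<and> phi i (x i) = 1"
    unfolding phi_def by (rule someI_ex[OF linear_functional_nonzero[OF x_nonzero[OF assms]]])
  show "phi i (u + v) = phi i u + phi i v" "phi i (scale c u) = c * phi i u" "phi i (x i) = 1"
    using * by blast+
qed

lemma phi_zero: "i \<in> I \<Longrightarrow> phi i 0 = 0"
  using phi_scale[of i 0 0] by simp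

lemma
  assumes "i \<in> I"
  shows p_add: "p i (u + v) = p i u + p i v" and p_scale: "p i (scale c u) = c * p i u"
    and q_add: "q i (u + v) = q i u + q i v" and q_scale: "q i (scale c u) = c * q i u"
    and p_zero: "p i 0 = 0" and q_zero: "q i 0 = 0"
  using assms
  by (simp_all add: p_def q_def phi_add phi_scale phi_zero bracket_add_left bracket_add_right
      bracket_scale_left bracket_scale_right)

lemma
  assumes "i \<in> I"
  shows p_sum: "p i (\<Sum>j\<in>J. f j) = (\<Sum>j\<in>J. p i (f j))"
    and q_sum: "q i (\<Sum>j\<in>J. f j) = (\<Sum>j\<in>J. q i (f j))"
  by (induction J rule: infinite_finite_induct) (simp_all add: assms p_zero q_zero p_add q_add)

lemma
  assumes "i \<in> I" "j \<in> I"
  shows p_e: "p i (e j) = (if j = i then 1 else 0)" and p_x: "p i (x j) = 0"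
    and q_e: "q i (e j) = 0" and q_x: "q i (x j) = (if j = i then 1 else 0)"
  using assms by (auto simp: p_def q_def br_ee br_xx br_ex phi_x phi_zero)

lemma
  assumes "i \<in> I"
  shows p_comb: "p i ((\<Sum>j\<in>I. scale (c j) (e j)) + (\<Sum>j\<in>I. scale (d j) (x j))) = c i"
    and q_comb: "q i ((\<Sum>j\<in>I. scale (c j) (e j)) + (\<Sum>j\<in>I. scale (d j) (x j))) = d i"
  using assms finite_I
  by (simp_all add: p_add q_add p_sum q_sum p_scale q_scale p_e p_x q_e q_x
      if_distrib[of "\<lambda>t. _ * t"] cong: if_cong)

lemma coords:
  assumes "v \<in> L"
  shows "v = (\<Sum>i\<in>I. scale (p i v) (e i)) + (\<Sum>i\<in>I. scale (q i v) (x i))"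
proof -
  obtain a b where "a \<in> span (e ` I)" "b \<in> span (x ` I)" "v = a + b"
    using assms by (auto simp: span_Un)
  moreover from this obtain c d where "a = (\<Sum>i\<in>I. scale (c i) (e i))" "b = (\<Sum>i\<in>I. scale (d i) (x i))"
    using span_image_sum[OF finite_I] by blast
  ultimately have v: "v = (\<Sum>i\<in>I. scale (c i) (e i)) + (\<Sum>i\<in>I. scale (d i) (x i))" by simp
  show ?thesis unfolding v by (simp only: p_comb q_comb cong: sum.cong)
qed

lemma coords_eqI:
  assumes "v \<in> L" "w \<in> L" "\<And>i. i \<in> I \<Longrightarrow> p i v = p i w" "\<And>i. i \<in> I \<Longrightarrow> q i v = q i w"
  shows "v = w"
  by (subst coords[OF assms(1)], subst coords[OF assms(2)]) (simp add: assms(3,4))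

lemma e_mem: "i \<in> I \<Longrightarrow> e i \<in> L" and x_mem: "i \<in> I \<Longrightarrow> x i \<in> L"
  by (simp_all add: span_base)

text \<open>Each pair contributes the determinant of its coordinates. The antisymmetry of these
  determinants later cancels the loop part of a bracket.\<close>

lemma bracket_L:
  assumes "v \<in> L" "w \<in> L"
  shows "bracket v w = (\<Sum>i\<in>I. scale (p i v * q i w - q i v * p i w) (x i))"
proof -
  let ?A = "\<lambda>v. \<Sum>i\<in>I. scale (p i v) (e i)" and ?X = "\<lambda>v. \<Sum>i\<in>I. scale (q i v) (x i)"
  have AA: "bracket (?A v) (?A w) = 0" and XX: "bracket (?X v) (?X w) = 0"
    by (simp_all add: bracket_sum_left bracket_sum_right bracket_scale_left bracket_scale_right br_ee br_xx)
  have AX: "bracket (?A v) (?X w) = (\<Sum>i\<in>I. scale (p i v * q i w) (x i))" for v w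
    using finite_I
    by (simp add: bracket_sum_left bracket_sum_right bracket_scale_left bracket_scale_right br_ex
        if_distrib[of "scale _"] mult.commute cong: if_cong sum.cong)
  have "bracket v w = bracket (?A v + ?X v) (?A w + ?X w)"
    using coords[OF assms(1)] coords[OF assms(2)] by simp
  also have "\<dots> = bracket (?A v) (?X w) - bracket (?A w) (?X v)"
    using AA XX
    by (simp only: bracket_add_left bracket_add_right bracket_anti[of "?X v" "?A w"]) simp
  also have "\<dots> = (\<Sum>i\<in>I. scale (p i v * q i w - q i v * p i w) (x i))"
    unfolding AX by (simp add: scale_left_diff_distrib sum_subtractf mult.commute)
  finally show ?thesis .
qed

lemma bracket_mem: "v \<in> L \<Longrightarrow> w \<in> L \<Longrightarrow> bracket v w \<in> L"
  by (auto simp: bracket_L intro!: span_sum span_scale x_mem)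

lemma p_bracket: "i \<in> I \<Longrightarrow> v \<in> L \<Longrightarrow> w \<in> L \<Longrightarrow> p i (bracket v w) = 0"
  by (simp add: bracket_L p_sum p_scale p_x)

lemma bracket_x_right: "i \<in> I \<Longrightarrow> v \<in> L \<Longrightarrow> bracket v (x i) = scale (p i v) (x i)"
  using finite_I by (simp add: bracket_L x_mem p_x q_x if_distrib[of "\<lambda>t. scale (_ * t) _"] cong: if_cong)

lemma bracket_e_left: "i \<in> I \<Longrightarrow> v \<in> L \<Longrightarrow> bracket (e i) v = scale (q i v) (x i)"
  using finite_I by (simp add: bracket_L e_mem p_e q_e if_distrib[of "\<lambda>t. scale (t * _) _"] cong: if_cong)

lemma bracket_e_right: "i \<in> I \<Longrightarrow> v \<in> L \<Longrightarrow> bracket v (e i) = scale (- q i v) (x i)"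
  using bracket_e_left[of i v] by (simp add: bracket_anti[of v])

text \<open>The sum \<open>E\<close> of the \<open>e i\<close> acts as 1 on all \<open>x j\<close>
  and as 0 on all \<open>e i\<close>. By invariance, the form can be nonzero only between
  eigenvectors of \<open>E\<close> whose eigenvalues add up to 0.\<close>

lemma
  assumes "i \<in> I" "j \<in> I"
  shows killing_xx: "K (x i) (x j) = 0" and killing_ex: "K (e i) (x j) = 0"
proof -
  define E where "E = (\<Sum>i\<in>I. e i)"
  have Ex: "bracket E (x k) = x k" if "k \<in> I" for k
    using that finite_I by (simp add: E_def bracket_sum_left br_ex cong: if_cong)
  have "K (bracket (x i) E) (x j) = K (x i) (bracket E (x j))"
    by (rule killing_invariant)
  then have "- K (x i) (x j) = K (x i) (x j)"
    using Ex assms killing_scale_left[of "-1"] by (simp add: bracket_anti[of _ E])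
  then have "2 * K (x i) (x j) = 0" by (metis add.right_inverse mult_2)
  then show "K (x i) (x j) = 0" by simp
  have "bracket (e i) E = 0"
    using assms by (simp add: E_def bracket_sum_right br_ee)
  then have "K (e i) (bracket E (x j)) = 0"
    using killing_invariant[of "e i" E "x j"] by simp
  then show "K (e i) (x j) = 0" using Ex assms by simp
qed

text \<open>Root vectors are orthogonal to \<open>L\<close>, so central terms of brackets see only
  the coordinates \<open>p\<close>.\<close>

lemma killing_x: "v \<in> L \<Longrightarrow> k \<in> I \<Longrightarrow> K v (x k) = 0"
  by (subst coords, assumption)
    (simp add: killing_add_left killing_sum_left killing_scale_left killing_xx killing_ex)

lemma killing_e: "v \<in> L \<Longrightarrow> k \<in> I \<Longrightarrow> K v (e k) = (\<Sum>i\<in>I. p i v * K (e i) (e k))"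
  by (subst coords, assumption)
    (simp add: killing_add_left killing_sum_left killing_scale_left killing_ex killing_sym[of "x _"])

lemma cf_mem: "u \<in> M \<Longrightarrow> cf u n \<in> L"
  by (simp add: mem_affinization)

lemma loop_mem: "v \<in> L \<Longrightarrow> loop v n \<in> M"
  by (simp add: mem_affinization cf_loop span_zero)

lemma M_add: "u \<in> M \<Longrightarrow> v \<in> M \<Longrightarrow> u + v \<in> M"
  by (simp add: mem_affinization span_add)

lemma M_scale: "u \<in> M \<Longrightarrow> AS c u \<in> M"
  by (simp add: mem_affinization span_scale)

lemma M_central: "AS c central_K \<in> M" "central_K \<in> M" "(0 :: ('k, 'a) affine) \<in> M"
  by (simp_all add: mem_affinization span_zero)

lemma M_BR: "u \<in> M \<Longrightarrow> v \<in> M \<Longrightarrow> BR u v \<in> M"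
  by (auto simp: mem_affinization cf_BR_supp intro!: span_sum bracket_mem)

text \<open>The component of \<open>u\<close> in the \<open>k\<close>-th two-dimensional algebra, multiplied by a power of \<open>t\<close>,
  commutes with \<open>u\<close> up to the centre. Positivity of the form provides a \<open>k\<close> for which the central
  term can be made nonzero.\<close>

lemma ex_BR_central:
  assumes u: "u \<in> M" and i: "i \<in> I" and m: "m \<noteq> 0" "p i (cf u m) \<noteq> 0"
  shows "\<exists>y\<in>M. BR u y = AS \<kappa> central_K"
proof -
  \<comment> \<open>Outside \<open>J\<close> the component of \<open>u\<close> has no part along
    \<open>e k\<close>, and its central term would vanish by \<open>killing_x\<close>. So
    \<open>gram\<close> is applied to \<open>J\<close>, to get \<open>k\<close> inside it.\<close>
  define J where "J = {i \<in> I. \<exists>n. p i (cf u n) \<noteq> 0}"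
  have J: "J \<subseteq> I" "i \<in> J" using i m by (auto simp: J_def)
  obtain k where k: "k \<in> J" "(\<Sum>i\<in>J. p i (cf u m) * K (e i) (e k)) \<noteq> 0"
    using gram[OF J(1) _ J(2), of "\<lambda>i. p i (cf u m)"] m(2) by blast
  have kI: "k \<in> I" using k J by blast
  have "K (cf u m) (e k) = (\<Sum>i\<in>J. p i (cf u m) * K (e i) (e k))"
    unfolding killing_e[OF cf_mem[OF u] kI]
    by (rule sum.mono_neutral_right[OF finite_I J(1)]) (auto simp: J_def)
  then have Kk: "K (cf u m) (e k) \<noteq> 0" using k(2) by simp
  obtain n0 where n0: "p k (cf u n0) \<noteq> 0" using k(1) by (auto simp: J_def)
  let ?S = "{n. cf u n \<noteq> 0}"
  have fin: "finite ?S" by simp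
  have "finite {n. p k (cf u n) \<noteq> 0}"
    by (rule finite_subset[OF _ fin]) (auto simp: p_zero[OF kI])
  moreover have "{n. of_int n * K (cf u n) (e k) \<noteq> 0} \<subseteq> ?S" by auto
  \<comment> \<open>The sum is the coefficient in degree \<open>r\<close> of a product of two
    Laurent polynomials. The first factor is nonzero in degree \<open>m\<close>, since
    \<open>m \<noteq> 0\<close>; the second is nonzero because \<open>k \<in> J\<close>.\<close>
  ultimately obtain r where
    r: "(\<Sum>n\<in>?S. (of_int n * K (cf u n) (e k)) * p k (cf u (r - n))) \<noteq> 0"
    using convolution_nonzero[of "\<lambda>n. p k (cf u n)" n0 ?S "\<lambda>n. of_int n * K (cf u n) (e k)" m]
      n0 Kk m(1) fin by auto
  \<comment> \<open>The component of \<open>u\<close> in the \<open>k\<close>-th algebra, multiplied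
    by the power \<open>-r\<close> of \<open>t\<close>.\<close>
  define f where "f n = scale (p k (cf u (n + r))) (e k) + scale (q k (cf u (n + r))) (x k)" for n
  have "finite {n. f n \<noteq> 0}"
  proof (rule finite_subset[OF _ finite_imageI[OF fin, of "\<lambda>n. n - r"]], rule subsetI)
    fix n assume "n \<in> {n. f n \<noteq> 0}"
    then have "n + r \<in> ?S" by (auto simp: f_def p_zero[OF kI] q_zero[OF kI])
    then show "n \<in> (\<lambda>n. n - r) ` ?S" by (rule rev_image_eqI) simp
  qed
  then obtain y :: "('k, 'a) affine" where y: "\<And>n. cf y n = f n"
    by (metis fst_conv lookup_Abs_poly_mapping)
  have fL: "f n \<in> L" for n
    using kI by (auto simp: f_def intro!: span_add span_scale e_mem x_mem)
  then have yM: "y \<in> M" by (simp add: mem_affinization y)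
  have pf: "p i (f n) = (if i = k then p k (cf u (n + r)) else 0)"
    and qf: "q i (f n) = (if i = k then q k (cf u (n + r)) else 0)" if "i \<in> I" for i n
    using that kI by (auto simp: f_def p_add q_add p_scale q_scale p_e p_x q_e q_x)
  have c0: "cf (BR u y) n = 0" for n
  proof -
    let ?R = "n + r"
    \<comment> \<open>The support of \<open>u\<close> is made symmetric under
      \<open>m \<mapsto> ?R - m\<close>. This reflection changes the sign of the determinants, so
      their sum is 0.\<close>
    let ?T = "?S \<union> (\<lambda>m. ?R - m) ` ?S"
    let ?g = "\<lambda>m. p k (cf u m) * q k (cf u (?R - m))"
    have "bij_betw (\<lambda>m. ?R - m) ?T ?T"
      by (rule bij_betw_byWitness[where f' = "\<lambda>m. ?R - m"]) auto
    then have sym: "(\<Sum>m\<in>?T. ?g (?R - m)) = (\<Sum>m\<in>?T. ?g m)"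
      by (rule sum.reindex_bij_betw)
    have br: "bracket (cf u m) (f (n - m)) = scale (?g m - ?g (?R - m)) (x k)" for m
    proof -
      have eq: "n - m + r = ?R - m" by simp
      have "bracket (cf u m) (f (n - m))
          = (\<Sum>i\<in>I. if i = k then scale (?g m - ?g (?R - m)) (x k) else 0)"
        unfolding bracket_L[OF cf_mem[OF u] fL]
        by (intro sum.cong[OF refl]) (simp add: pf qf eq mult.commute)
      then show ?thesis using kI finite_I by simp
    qed
    have "cf (BR u y) n = (\<Sum>m\<in>?T. bracket (cf u m) (f (n - m)))"
      by (subst cf_BR[where S = ?T]) (auto simp: y)
    also have "\<dots> = scale ((\<Sum>m\<in>?T. ?g m) - (\<Sum>m\<in>?T. ?g (?R - m))) (x k)"
      unfolding br by (simp add: scale_sum_left[symmetric] sum_subtractf)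
    finally show ?thesis using sym by simp
  qed
  define c where "c = snd (BR u y)"
  have "c = (\<Sum>n\<in>?S. (of_int n * K (cf u n) (e k)) * p k (cf u (r - n)))"
    unfolding c_def snd_BR_supp y f_def using kI cf_mem[OF u]
    by (simp add: killing_add_right killing_scale_right killing_x mult_ac)
  then have "c \<noteq> 0" using r by simp
  then have "BR u (AS (\<kappa> / c) y) = AS \<kappa> central_K"
    unfolding BR_scale_right by (intro affine_eqI) (simp_all add: c0 c_def)
  then show ?thesis using M_scale[OF yM] by blast
qed

text \<open>The pointwise sums of multiples of the maps \<open>D\<^sub>i\<^sub>j\<close> are exactly these maps.\<close>

definition cent :: "(int \<Rightarrow> 'i \<Rightarrow> 'k) \<Rightarrow> ('k, 'a) affine \<Rightarrow> ('k, 'a) affine" where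
  "cent a u = (if u \<in> M
     then AS (\<Sum>n\<in>{n. cf u n \<noteq> 0}. \<Sum>i\<in>I. a n i * p i (cf u n)) central_K else 0)"

lemma cent_eq:
  assumes "u \<in> M" "finite S" "\<And>n. cf u n \<noteq> 0 \<Longrightarrow> n \<in> S"
  shows "cent a u = AS (\<Sum>n\<in>S. \<Sum>i\<in>I. a n i * p i (cf u n)) central_K"
proof -
  have "(\<Sum>n\<in>{n. cf u n \<noteq> 0}. \<Sum>i\<in>I. a n i * p i (cf u n)) = (\<Sum>n\<in>S. \<Sum>i\<in>I. a n i * p i (cf u n))"
    using assms by (intro sum.mono_neutral_left) (auto simp: p_zero)
  then show ?thesis using assms(1) by (simp add: cent_def)
qed

lemma cf_cent [simp]: "cf (cent a u) n = 0"
  by (simp add: cent_def)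

lemma cent_loop:
  assumes "v \<in> L"
  shows "cent a (loop v n) = AS (\<Sum>i\<in>I. a n i * p i v) central_K"
  by (subst cent_eq[where S = "{n}"]) (auto simp: cf_loop loop_mem assms split: if_splits)

lemma cent_central_K: "cent a central_K = 0"
  by (subst cent_eq[where S = "{}"]) (auto simp: M_central intro!: affine_eqI)

lemma cent_derived:
  assumes "\<And>n i. i \<in> I \<Longrightarrow> p i (cf u n) = 0"
  shows "cent a u = 0"
  by (auto simp: cent_def assms intro!: affine_eqI)

lemma cent_endomorphism: "cent a \<in> endomorphisms AS M"
proof -
  have add: "cent a (u + v) = cent a u + cent a v" if "u \<in> M" "v \<in> M" for u v
  proof -
    let ?S = "{n. cf u n \<noteq> 0} \<union> {n. cf v n \<noteq> 0}"
    have "cent a z = AS (\<Sum>n\<in>?S. \<Sum>i\<in>I. a n i * p i (cf z n)) central_K" if "z \<in> {u + v, u, v}" for z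
      by (rule cent_eq) (use that \<open>u \<in> M\<close> \<open>v \<in> M\<close> M_add[OF \<open>u \<in> M\<close> \<open>v \<in> M\<close>] in auto)
    then show ?thesis
      by (simp, intro affine_eqI) (auto simp: p_add distrib_left sum.distrib)
  qed
  have hom: "cent a (AS c u) = AS c (cent a u)" if "u \<in> M" for c u
  proof -
    let ?S = "{n. cf u n \<noteq> 0}"
    have "cent a z = AS (\<Sum>n\<in>?S. \<Sum>i\<in>I. a n i * p i (cf z n)) central_K" if "z \<in> {AS c u, u}" for z
      by (rule cent_eq) (use that \<open>u \<in> M\<close> M_scale[OF \<open>u \<in> M\<close>] in auto)
    then show ?thesis
      by (simp, intro affine_eqI) (auto simp: p_scale sum_distrib_left mult_ac)
  qed
  have mem: "cent a u \<in> M" for u by (simp add: mem_affinization span_zero)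
  have out: "cent a u = 0" if "u \<notin> M" for u using that by (simp add: cent_def)
  show ?thesis
    unfolding endomorphisms_def by (intro CollectI conjI ballI allI impI add hom mem out)
qed

text \<open>A linear map with central values that kills all brackets is a derivation; brackets are
  killed because their coordinates \<open>p\<close> vanish.\<close>

lemma cent_derivation: "cent a \<in> derivations AS BR M"
proof -
  have "cent a (BR u v) = 0" if "u \<in> M" "v \<in> M" for u v
    using that by (intro cent_derived) (simp add: cf_BR_supp p_sum p_bracket cf_mem)
  moreover have "BR (cent a u) v = 0" "BR v (cent a u) = 0" for u v
    by (simp_all add: BR_central_left BR_central_right)
  ultimately show ?thesis using cent_endomorphism by (simp add: derivations_def)
qed

text \<open>Without a coefficient in degree 0, a nonzero value at \<open>u\<close> requires a
  nonzero coordinate \<open>p\<close> in some degree other than 0, which is the input of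
  \<open>ex_BR_central\<close>.\<close>

lemma cent_AID:
  assumes "\<And>i. i \<in> I \<Longrightarrow> a 0 i = 0"
  shows "cent a \<in> AID AS BR M"
proof -
  have "\<exists>y. y \<in> M \<and> cent a u = BR u y" if u: "u \<in> M" for u
  proof (cases "cent a u = 0")
    case True
    then show ?thesis using M_central(3) by (intro exI[of _ 0]) simp
  next
    case False
    have "\<exists>n i. n \<noteq> 0 \<and> i \<in> I \<and> p i (cf u n) \<noteq> 0"
    proof (rule ccontr)
      assume "\<nexists>n i. n \<noteq> 0 \<and> i \<in> I \<and> p i (cf u n) \<noteq> 0"
      then have z: "a n i * p i (cf u n) = 0" if "i \<in> I" for n i
        using that assms by (cases "n = 0") auto
      have "cent a u = 0"
        by (rule affine_eqI) (auto simp: cent_def z intro!: sum.neutral)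
      then show False using False by simp
    qed
    then obtain y where "y \<in> M" "BR u y = AS (snd (cent a u)) central_K"
      using ex_BR_central[OF u] by blast
    moreover have "AS (snd (cent a u)) central_K = cent a u" by (rule affine_eqI) auto
    ultimately show ?thesis by metis
  qed
  then show ?thesis using cent_derivation unfolding AID_def by blast
qed

section \<open>Comparison with inner derivations\<close>

definition inner :: "('k, 'a) affine \<Rightarrow> ('k, 'a) affine \<Rightarrow> ('k, 'a) affine" where
  "inner y u = (if u \<in> M then BR y u else 0)"

lemma Inn_eq: "Inn BR M = inner ` M"
proof -
  have "inner = (\<lambda>y u. if u \<in> M then BR y u else 0)"
    by (intro ext) (simp add: inner_def)
  then show ?thesis unfolding Inn_def by (simp only: Setcompr_eq_image)
qed

text \<open>Brackets of \<open>y\<close> with \<open>x i\<close> and \<open>e i\<close> in degree 0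
  reveal all its coordinates \<open>p\<close> and \<open>q\<close>. If their loop parts vanish,
  \<open>y\<close> is central. So maps with central values are independent modulo \<open>Inn\<close>
  as soon as they are independent.\<close>

lemma central_Inn_zero:
  assumes F: "F \<in> Inn BR M" and c: "\<And>u n. cf (F u) n = 0"
  shows "F = 0"
proof -
  obtain y where y: "y \<in> M" and F: "F = inner y" using F by (auto simp: Inn_eq)
  have "cf y n = 0" for n
  proof (rule coords_eqI[OF cf_mem[OF y] span_zero])
    fix i assume i: "i \<in> I"
    have "cf (F (loop (x i) 0)) n = scale (p i (cf y n)) (x i)"
      unfolding F inner_def using i y
      by (simp add: loop_mem x_mem cf_BR_loop_right bracket_x_right cf_mem)
    then show "p i (cf y n) = p i 0" using c x_nonzero[OF i] i by (simp add: p_zero)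
    have "cf (F (loop (e i) 0)) n = scale (- q i (cf y n)) (x i)"
      unfolding F inner_def using i y
      by (simp add: loop_mem e_mem cf_BR_loop_right bracket_e_right cf_mem)
    then show "q i (cf y n) = q i 0" using c x_nonzero[OF i] i by (simp add: q_zero)
  qed
  then show ?thesis by (simp add: F inner_def BR_central_left fun_eq_iff)
qed

lemma AID_decomp:
  assumes E: "E \<in> AID AS BR M"
  shows "\<exists>a. \<exists>y\<in>M. (\<forall>i\<in>I. a 0 i = 0) \<and> E = cent a + inner y"
proof -
  have end_E: "E \<in> endomorphisms AS M" and der: "\<And>u v. u \<in> M \<Longrightarrow> v \<in> M \<Longrightarrow> E (BR u v) = BR (E u) v + BR u (E v)"
    and "\<forall>u\<in>M. \<exists>w\<in>M. E u = BR u w"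
    using E by (auto simp: AID_def derivations_def)
  then obtain w where w: "\<And>u. u \<in> M \<Longrightarrow> w u \<in> M" "\<And>u. u \<in> M \<Longrightarrow> E u = BR u (w u)" by metis
  have EM: "E u \<in> M" if "u \<in> M" for u using mem_endomorphismsD(1)[OF end_E that] .
  note lm = loop_mem[OF e_mem] loop_mem[OF x_mem]
  define \<xi> where "\<xi> i n m = q i (cf (E (loop (e i) n)) m)" for i n m
  define \<eta> where "\<eta> i n m = q i (cf (E (loop (x i) n)) m)" for i n m
  have Ee: "cf (E (loop (e i) n)) m = scale (\<xi> i n m) (x i)" if i: "i \<in> I" for i n m
  proof -
    have "cf (E (loop (e i) n)) m = scale (q i (cf (w (loop (e i) n)) (m - n))) (x i)"
      using i w lm(1)[OF i] by (simp add: cf_BR_loop_left bracket_e_left cf_mem)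
    then show ?thesis using i by (simp add: \<xi>_def q_scale q_x)
  qed
  have Ex: "cf (E (loop (x i) n)) m = scale (\<eta> i n m) (x i)" if i: "i \<in> I" for i n m
  proof -
    have "cf (E (loop (x i) n)) m = scale (- p i (cf (w (loop (x i) n)) (m - n))) (x i)"
      using i w lm(2)[OF i] bracket_x_right
      by (simp add: cf_BR_loop_left bracket_anti[of "x i"] cf_mem)
    moreover from this have "\<eta> i n m = - p i (cf (w (loop (x i) n)) (m - n))"
      using i by (simp del: scale_minus_left add: \<eta>_def q_scale q_x)
    ultimately show ?thesis by simp
  qed
  \<comment> \<open>The value is a bracket with a loop of \<open>x i\<close>, which is orthogonal to
    \<open>L\<close>. The analogue for \<open>e i\<close> holds only in degree 0.\<close>
  have sx: "snd (E (loop (x i) n)) = 0" if i: "i \<in> I" for i n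
    using i w lm(2)[OF i] by (simp add: snd_BR_loop_left killing_x cf_mem killing_sym[of "x i"])
  have se: "snd (E (loop (e i) 0)) = 0" if i: "i \<in> I" for i
    using i w lm(1)[OF i] by (simp add: snd_BR_loop_left)
  \<comment> \<open>The signs come from \<open>bracket_x_right\<close> and
    \<open>bracket_e_right\<close>: bracketing \<open>y\<close> with \<open>x i\<close> reads off
    \<open>p\<close>, with \<open>e i\<close> it reads off \<open>- q\<close>.\<close>
  define f where "f n = (\<Sum>i\<in>I. scale (\<eta> i 0 n) (e i)) + (\<Sum>i\<in>I. scale (- \<xi> i 0 n) (x i))" for n
  have "{n. f n \<noteq> 0} \<subseteq> (\<Union>i\<in>I. {n. cf (E (loop (x i) 0)) n \<noteq> 0} \<union> {n. cf (E (loop (e i) 0)) n \<noteq> 0})"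
  proof (rule subsetI, rule ccontr)
    fix n assume n: "n \<in> {n. f n \<noteq> 0}"
      "n \<notin> (\<Union>i\<in>I. {n. cf (E (loop (x i) 0)) n \<noteq> 0} \<union> {n. cf (E (loop (e i) 0)) n \<noteq> 0})"
    then have "\<eta> i 0 n = 0" "\<xi> i 0 n = 0" if "i \<in> I" for i
      using that by (auto simp: \<xi>_def \<eta>_def q_zero)
    then show False using n by (simp add: f_def)
  qed
  then have "finite {n. f n \<noteq> 0}" by (rule finite_subset) (simp add: finite_I)
  then obtain y :: "('k, 'a) affine" where y: "\<And>n. cf y n = f n"
    by (metis fst_conv lookup_Abs_poly_mapping)
  have yM: "y \<in> M"
    by (auto simp: mem_affinization y f_def intro!: span_add span_sum span_scale span_neg e_mem x_mem)
  note yL = cf_mem[OF yM]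
  have py: "p i (cf y n) = \<eta> i 0 n" and qy: "q i (cf y n) = - \<xi> i 0 n" if "i \<in> I" for i n
    unfolding y f_def using that by (rule p_comb q_comb)+
  \<comment> \<open>The term with \<open>E (loop (e i) n)\<close> drops out, since its loop part
    consists of multiples of \<open>x i\<close>. So the image in degree \<open>n\<close> is the one
    in degree 0, shifted by \<open>n\<close>.\<close>
  have \<eta>: "E (loop (x i) n) = BR y (loop (x i) n)" if i: "i \<in> I" for i n
  proof (rule affine_eqI)
    note em = lm(1)[OF i, of n] lm(2)[OF i, of 0]
    have "E (loop (x i) n) = E (BR (loop (e i) n) (loop (x i) 0))"
      by (rule arg_cong[where f = E], rule affine_eqI)
        (use i in \<open>auto simp: cf_BR_loop_left snd_BR_loop_left cf_loop br_ex killing_ex\<close>)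
    also have "\<dots> = BR (E (loop (e i) n)) (loop (x i) 0) + BR (loop (e i) n) (E (loop (x i) 0))"
      by (rule der[OF em])
    also have "BR (E (loop (e i) n)) (loop (x i) 0) = 0"
      by (rule affine_eqI) (use i in \<open>simp_all add: cf_BR_loop_right snd_BR_loop_right Ee
          bracket_scale_left bracket_self\<close>)
    finally have "cf (E (loop (x i) n)) m = cf (BR (loop (e i) n) (E (loop (x i) 0))) m" for m by simp
    then show "cf (E (loop (x i) n)) m = cf (BR y (loop (x i) n)) m" for m
      using i by (simp add: cf_BR_loop_left cf_BR_loop_right Ex bracket_scale_right br_ex
          bracket_x_right yL py)
    show "snd (E (loop (x i) n)) = snd (BR y (loop (x i) n))"
      using i by (simp add: sx snd_BR_loop_right killing_x yL)
  qed
  \<comment> \<open>The two loop parts in the Leibniz rule carry opposite signs, so their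
    cancellation says that \<open>\<xi>\<close> depends only on \<open>m - n\<close>.\<close>
  have \<xi>: "cf (E (loop (e i) n)) m = cf (BR y (loop (e i) n)) m" if i: "i \<in> I" for i n m
  proof -
    note em = lm(1)[OF i, of n] lm(1)[OF i, of 0]
    have "BR (loop (e i) n) (loop (e i) 0) = 0"
      by (rule affine_eqI) (use i in \<open>auto simp: cf_BR_loop_left snd_BR_loop_left cf_loop br_ee\<close>)
    moreover have "E 0 = 0"
      using mem_endomorphismsD(2)[OF end_E M_central(3) M_central(3)] by simp
    ultimately have "0 = BR (E (loop (e i) n)) (loop (e i) 0) + BR (loop (e i) n) (E (loop (e i) 0))"
      using der[OF em] by simp
    then have "0 = cf (BR (E (loop (e i) n)) (loop (e i) 0) + BR (loop (e i) n) (E (loop (e i) 0))) m"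
      by (metis fst_zero lookup_zero)
    then have "scale (\<xi> i 0 (m - n)) (x i) = scale (\<xi> i n m) (x i)"
      using i by (simp add: cf_BR_loop_left cf_BR_loop_right Ee bracket_scale_left bracket_scale_right
          br_ex bracket_anti[of "x i" "e i"])
    then have "\<xi> i n m = \<xi> i 0 (m - n)" using x_nonzero[OF i] by simp
    then show ?thesis
      using i by (simp add: Ee cf_BR_loop_right bracket_e_right yL qy)
  qed
  \<comment> \<open>The loop parts already agree with those of \<open>y\<close>, so only a central
    discrepancy is left; both of its terms are 0 in degree 0.\<close>
  define a where "a n i = snd (E (loop (e i) n)) - snd (BR y (loop (e i) n))" for n i
  have a0: "\<forall>i\<in>I. a 0 i = 0" by (simp add: a_def se snd_BR_loop_right)
  have "inner y \<in> endomorphisms AS M"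
    unfolding endomorphisms_def inner_def using yM
    by (simp add: M_BR M_add M_scale BR_add_right BR_scale_right)
  then have end_sum: "cent a + inner y \<in> endomorphisms AS M"
    using cent_endomorphism[of a] unfolding endomorphisms_def
    by (auto simp: plus_fun_apply M_add algebra_simps intro!: affine_eqI)
  have "E = cent a + inner y"
  proof (rule endomorphism_eqI[OF refl end_E end_sum])
    fix g n assume "g \<in> e ` I \<union> x ` I"
    then consider i where "i \<in> I" "g = e i" | i where "i \<in> I" "g = x i" by auto
    then show "E (loop g n) = (cent a + inner y) (loop g n)"
    proof cases
      case (1 i)
      have "cent a (loop (e i) n) = AS (a n i) central_K"
        using 1 finite_I by (simp add: cent_loop e_mem p_e if_distrib[of "\<lambda>t. _ * t"] cong: if_cong)
      then show ?thesis
        using 1 lm(1) by (intro affine_eqI) (auto simp: plus_fun_apply inner_def \<xi> a_def)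
    next
      case (2 i)
      then show ?thesis
        using lm(2)[OF 2(1)] by (simp add: plus_fun_apply inner_def cent_derived cf_loop p_x p_zero \<eta>)
    qed
  next
    show "E central_K = (cent a + inner y) central_K"
      using w[OF M_central(2)]
      by (simp add: plus_fun_apply cent_central_K inner_def BR_central_left BR_central_right)
  qed
  then show ?thesis using a0 yM by blast
qed

end

section \<open>The maps \<open>D\<^sub>i\<^sub>j\<close>\<close>

text \<open>Keeps the index interval in the form \<open>{1..l}\<close>, in which the facts about
  \<open>h\<close> are stated.\<close>

declare One_nat_def [simp del]

locale split_pairs_basis = split_pairs scale bracket I e x
  for scale :: "'k::field_char_0 \<Rightarrow> 'a::ab_group_add \<Rightarrow> 'a" and bracket :: "'a \<Rightarrow> 'a \<Rightarrow> 'a"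
    and I :: "'i set" and e x :: "'i \<Rightarrow> 'a" +
  fixes l :: nat and h :: "nat \<Rightarrow> 'a"
  assumes inj_h: "inj_on h {1..l}" and independent_h: "independent (h ` {1..l})"
    and span_h: "span (h ` {1..l}) = span (e ` I)"
    and derived: "lie_product scale bracket L L = span (x ` I)"
begin

definition r :: "nat \<Rightarrow> 'a \<Rightarrow> 'k" where
  "r i v = representation (h ` {1..l}) v (h i)"

lemma h_mem: "i \<in> {1..l} \<Longrightarrow> h i \<in> span (e ` I)"
  using span_h by (metis imageI span_base)

lemma h_mem_L: "i \<in> {1..l} \<Longrightarrow> h i \<in> L"
  using h_mem span_mono[of "e ` I" "e ` I \<union> x ` I"] by blast

lemma r_h: "i \<in> {1..l} \<Longrightarrow> j \<in> {1..l} \<Longrightarrow> r i (h j) = (if j = i then 1 else 0)"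
  using inj_onD[OF inj_h] by (auto simp: r_def representation_basis[OF independent_h])

lemma span_e_coords: "v \<in> span (e ` I) \<Longrightarrow> v = (\<Sum>k\<in>I. scale (p k v) (e k))"
  using finite_I
  by (auto dest!: span_image_sum[OF finite_I] intro!: sum.cong
      simp: p_sum p_scale p_e if_distrib[of "\<lambda>t. _ * t"] cong: if_cong)

lemma r_coords: "v \<in> span (e ` I) \<Longrightarrow> (\<Sum>k\<in>I. r i (e k) * p k v) = r i v"
  by (subst (3) span_e_coords)
    (simp_all add: r_def representation_sum[OF independent_h] representation_scale[OF independent_h]
      span_h span_scale span_base mult.commute)

lemma h_coords: "v \<in> span (e ` I) \<Longrightarrow> (\<Sum>i\<in>{1..l}. scale (r i v) (h i)) = v"
  using sum_representation_eq[OF independent_h, of v "h ` {1..l}"] span_h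
  by (simp add: r_def sum.reindex[OF inj_h])

text \<open>On \<open>H\<close>, the coordinate functional \<open>r i\<close> is the combination of
  the \<open>p k\<close> with coefficients \<open>r i (e k)\<close>. Placed in degree
  \<open>j\<close>, these present \<open>D\<^sub>i\<^sub>j\<close> as a map
  \<open>cent\<close>.\<close>

definition dcoef :: "nat \<Rightarrow> int \<Rightarrow> int \<Rightarrow> 'i \<Rightarrow> 'k" where
  "dcoef i j n k = (if n = j then r i (e k) else 0)"

lemma span_hx: "L = span (h ` {1..l} \<union> x ` I)"
  unfolding span_Un span_h ..

lemma cent_dcoef_h:
  assumes "i \<in> {1..l}" "m \<in> {1..l}"
  shows "cent (dcoef i j) (loop (h m) n) = (if i = m \<and> j = n then central_K else 0)"
proof -
  have "(\<Sum>k\<in>I. dcoef i j n k * p k (h m)) = (if i = m \<and> j = n then 1 else 0)"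
    using assms r_coords[OF h_mem, of m i] by (cases "n = j") (auto simp: dcoef_def r_h)
  then show ?thesis
    using assms by (auto simp: cent_loop h_mem_L intro!: affine_eqI)
qed

lemma D_spec_cent:
  assumes i: "i \<in> {1..l}"
  shows "D_spec scale bracket L l h i j (cent (dcoef i j))"
proof -
  have "cent a u = 0" if "u \<in> loop_space (span (x ` I))" for a u
  proof (rule cent_derived)
    fix n k assume k: "k \<in> I"
    have "cf u n \<in> span (x ` I)" using that by (auto simp: loop_space_def)
    then obtain c where "cf u n = (\<Sum>i\<in>I. scale (c i) (x i))" using span_image_sum[OF finite_I] by blast
    then show "p k (cf u n) = 0" using k by (simp add: p_sum p_scale p_x)
  qed
  then show ?thesis
    unfolding D_spec_def derived
    using cent_endomorphism cent_central_K cent_dcoef_h[OF i] by blast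
qed

lemma D_spec_unique:
  assumes i: "i \<in> {1..l}" and E: "D_spec scale bracket L l h i j E"
  shows "E = cent (dcoef i j)"
proof (rule endomorphism_eqI[OF span_hx _ cent_endomorphism])
  let ?F = "cent (dcoef i j)"
  note F = D_spec_cent[OF i, of j]
  show "E \<in> endomorphisms AS M" using E by (simp add: D_spec_def)
  show "E central_K = ?F central_K" using E F by (simp add: D_spec_def)
  fix g n assume "g \<in> h ` {1..l} \<union> x ` I"
  then show "E (loop g n) = ?F (loop g n)"
  proof
    assume "g \<in> h ` {1..l}"
    then show ?thesis using E F by (auto simp: D_spec_def)
  next
    assume "g \<in> x ` I"
    then have "(loop g n :: ('k, 'a) affine) \<in> loop_space (span (x ` I))"
      by (auto simp: loop_space_def loop_def lookup_single when_def span_zero intro: span_base)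
    then show ?thesis using E F by (simp add: D_spec_def derived)
  qed
qed

lemma D_map_eq: "i \<in> {1..l} \<Longrightarrow> D_map scale bracket L l h i j = cent (dcoef i j)"
  unfolding D_map_def by (rule the_equality) (auto intro: D_spec_cent D_spec_unique)

lemma cent_dcoef:
  assumes "u \<in> M"
  shows "cent (dcoef i j) u = AS (\<Sum>k\<in>I. r i (e k) * p k (cf u j)) central_K"
proof -
  let ?S = "insert j {n. cf u n \<noteq> 0}"
  have "cent (dcoef i j) u = AS (\<Sum>n\<in>?S. \<Sum>k\<in>I. dcoef i j n k * p k (cf u n)) central_K"
    by (rule cent_eq[OF assms]) auto
  also have "(\<Sum>n\<in>?S. \<Sum>k\<in>I. dcoef i j n k * p k (cf u n)) = 
      (\<Sum>n\<in>?S. if n = j then \<Sum>k\<in>I. r i (e k) * p k (cf u n) else 0)"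
    by (rule sum.cong[OF refl]) (simp add: dcoef_def)
  also have "\<dots> = (\<Sum>k\<in>I. r i (e k) * p k (cf u j))"
    by (subst sum.delta) auto
  finally show ?thesis .
qed

lemma AS_zero [simp]: "AS 0 u = 0" "AS c 0 = 0"
  by (auto intro!: affine_eqI)

lemma AS_AS: "AS c (AS d u) = AS (c * d) u"
  by (auto intro!: affine_eqI)

lemma AS_sum: "(\<Sum>i\<in>S. AS (c i) u) = AS (\<Sum>i\<in>S. c i) u"
proof (induction S rule: infinite_finite_induct)
  case (insert i S)
  then show ?case by (auto simp: scale_left_distrib distrib_right intro!: affine_eqI)
qed simp_all

lemma scaled_D:
  assumes "i \<in> {1..l}"
  shows "map_scale AS c (D_map scale bracket L l h i j) u =
    (if u \<in> M then AS (c * (\<Sum>k\<in>I. r i (e k) * p k (cf u j))) central_K else 0)"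
  by (simp add: map_scale_def D_map_eq[OF assms] cent_dcoef AS_AS) (simp add: cent_def)

text \<open>The map with index \<open>j\<close> sees only the coefficient of
  \<open>t\<^sup>j\<close>, and an element has finitely many nonzero coefficients.\<close>

lemma pointwise_finite_D:
  "pointwise_finite ({1..l} \<times> UNIV) (\<lambda>(i, j). map_scale AS (a i j) (D_map scale bracket L l h i j))"
  unfolding pointwise_finite_def
proof
  fix u :: "('k, 'a) affine"
  have "{ij \<in> {1..l} \<times> UNIV. (case ij of (i, j) \<Rightarrow> map_scale AS (a i j) (D_map scale bracket L l h i j)) u \<noteq> 0}
      \<subseteq> {1..l} \<times> {n. cf u n \<noteq> 0}"
    by (auto simp: scaled_D p_zero split: if_splits)
  then show "finite {ij \<in> {1..l} \<times> UNIV.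
      (case ij of (i, j) \<Rightarrow> map_scale AS (a i j) (D_map scale bracket L l h i j)) u \<noteq> 0}"
    by (rule finite_subset) simp
qed

text \<open>On a fixed \<open>u\<close> only degrees in its support count, so the sums are finite
  and can be rearranged; the new coefficients come from the change from the basis dual to
  \<open>h\<close> to the one dual to \<open>e\<close>. The set \<open>T\<close> is general to cover
  both all degrees and the nonzero ones.\<close>

lemma pointwise_sum_D:
  "pointwise_sum ({1..l} \<times> T) (\<lambda>(i, j). map_scale AS (a i j) (D_map scale bracket L l h i j))
    = cent (\<lambda>n k. if n \<in> T then \<Sum>i\<in>{1..l}. a i n * r i (e k) else 0)"
proof
  fix u :: "('k, 'a) affine"
  let ?F = "\<lambda>(i, j). map_scale AS (a i j) (D_map scale bracket L l h i j)"
  let ?S = "{n. cf u n \<noteq> 0}"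
  show "pointwise_sum ({1..l} \<times> T) ?F u
    = cent (\<lambda>n k. if n \<in> T then \<Sum>i\<in>{1..l}. a i n * r i (e k) else 0) u"
  proof (cases "u \<in> M")
    case True
    have "pointwise_sum ({1..l} \<times> T) ?F u = (\<Sum>ij\<in>{1..l} \<times> (?S \<inter> T). ?F ij u)"
      unfolding pointwise_sum_def
      by (rule sum.mono_neutral_left) (auto simp: scaled_D p_zero split: if_splits)
    also have "\<dots> = (\<Sum>(i, j)\<in>{1..l} \<times> (?S \<inter> T).
        AS (a i j * (\<Sum>k\<in>I. r i (e k) * p k (cf u j))) central_K)"
      using True by (intro sum.cong) (auto simp: scaled_D)
    also have "\<dots> = AS (\<Sum>(i, j)\<in>{1..l} \<times> (?S \<inter> T). a i j * (\<Sum>k\<in>I. r i (e k) * p k (cf u j))) central_K"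
      by (simp only: case_prod_unfold AS_sum)
    also have "(\<Sum>(i, j)\<in>{1..l} \<times> (?S \<inter> T). a i j * (\<Sum>k\<in>I. r i (e k) * p k (cf u j)))
        = (\<Sum>i\<in>{1..l}. \<Sum>j\<in>?S \<inter> T. a i j * (\<Sum>k\<in>I. r i (e k) * p k (cf u j)))"
      by (rule sum.cartesian_product[symmetric])
    also have "\<dots> = (\<Sum>i\<in>{1..l}. \<Sum>j\<in>?S \<inter> T. \<Sum>k\<in>I. a i j * r i (e k) * p k (cf u j))"
      by (simp add: sum_distrib_left mult.assoc)
    also have "\<dots> = (\<Sum>j\<in>?S \<inter> T. \<Sum>k\<in>I. \<Sum>i\<in>{1..l}. a i j * r i (e k) * p k (cf u j))"
      by (subst sum.swap, rule sum.cong[OF refl], subst sum.swap) simp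
    also have "\<dots> = (\<Sum>j\<in>?S \<inter> T. \<Sum>k\<in>I. (\<Sum>i\<in>{1..l}. a i j * r i (e k)) * p k (cf u j))"
      by (simp add: sum_distrib_right)
    also have "\<dots> = (\<Sum>j\<in>?S. \<Sum>k\<in>I. (if j \<in> T then \<Sum>i\<in>{1..l}. a i j * r i (e k) else 0) * p k (cf u j))"
      by (rule sum.mono_neutral_cong_left) (auto intro: sum.neutral)
    finally show ?thesis using True by (simp add: cent_def)
  next
    case False
    then show ?thesis by (auto simp: pointwise_sum_def cent_def scaled_D intro!: sum.neutral)
  qed
qed

lemma cent_eq_pointwise_sum:
  assumes "\<And>k. k \<in> I \<Longrightarrow> c 0 k = 0"
  shows "\<exists>a. cent c = pointwise_sum ({1..l} \<times> (- {0}))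
    (\<lambda>(i, j). map_scale AS (a i j) (D_map scale bracket L l h i j))"
proof -
  \<comment> \<open>In the basis dual to \<open>h\<close>, the coordinates of a functional are its
    values at the \<open>h i\<close>; here the functional has coefficients \<open>c n k\<close> with
    respect to the \<open>p k\<close>.\<close>
  let ?a = "\<lambda>i n. \<Sum>k\<in>I. c n k * p k (h i)"
  have "c n k = (\<Sum>i\<in>{1..l}. ?a i n * r i (e k))" if k: "k \<in> I" for n k
  proof -
    have "(\<Sum>i\<in>{1..l}. ?a i n * r i (e k)) = (\<Sum>i\<in>{1..l}. \<Sum>m\<in>I. c n m * (r i (e k) * p m (h i)))"
      unfolding sum_distrib_right by (simp add: mult_ac)
    also have "\<dots> = (\<Sum>m\<in>I. \<Sum>i\<in>{1..l}. c n m * (r i (e k) * p m (h i)))"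
      by (rule sum.swap)
    also have "\<dots> = (\<Sum>m\<in>I. c n m * p m (\<Sum>i\<in>{1..l}. scale (r i (e k)) (h i)))"
      by (simp add: p_sum p_scale sum_distrib_left)
    also have "(\<Sum>i\<in>{1..l}. scale (r i (e k)) (h i)) = e k"
      using k by (intro h_coords span_base) auto
    also have "(\<Sum>m\<in>I. c n m * p m (e k)) = c n k"
      using k finite_I by (simp add: p_e if_distrib[of "\<lambda>t. _ * t"] cong: if_cong)
    finally show ?thesis by simp
  qed
  then have eq: "(if n \<in> - {0} then \<Sum>i\<in>{1..l}. ?a i n * r i (e k) else 0) = c n k" if "k \<in> I" for n k
    using that assms by auto
  have "cent c = cent (\<lambda>n k. if n \<in> - {0} then \<Sum>i\<in>{1..l}. ?a i n * r i (e k) else 0)"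
    unfolding cent_def[abs_def] by (simp only: eq cong: sum.cong)
  then show ?thesis unfolding pointwise_sum_D by (rule exI[of _ ?a])
qed

section \<open>Cosets modulo inner derivations\<close>

abbreviation "\<N> \<equiv> Inn BR M"

lemma inner_add: "inner y + inner z = inner (y + z)"
  by (rule ext) (simp add: inner_def plus_fun_apply BR_add_left)

lemma Inn_add: "F \<in> \<N> \<Longrightarrow> G \<in> \<N> \<Longrightarrow> F + G \<in> \<N>"
  unfolding Inn_eq by (elim imageE) (simp only: inner_add, intro imageI M_add)

lemma Inn_zero: "0 \<in> \<N>"
proof -
  have "0 = inner 0" by (rule ext) (simp add: inner_def)
  then show ?thesis using M_central(3) unfolding Inn_eq by blast
qed

lemma Inn_minus: "F \<in> \<N> \<Longrightarrow> - F \<in> \<N>"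
proof -
  have "- inner y = inner (- y)" for y
    by (rule ext) (simp add: inner_def BR_minus_left)
  moreover have "- y \<in> M" if "y \<in> M" for y
    using that by (simp add: mem_affinization span_neg)
  ultimately show "F \<in> \<N> \<Longrightarrow> - F \<in> \<N>" unfolding Inn_eq by fastforce
qed

lemma coset_absorb:
  assumes "G \<in> \<N>"
  shows "(F + G) +o \<N> = F +o \<N>"
proof (rule set_eqI)
  fix X
  have "(\<exists>n\<in>\<N>. X = F + G + n) \<longleftrightarrow> (\<exists>n\<in>\<N>. X = F + n)"
  proof
    assume "\<exists>n\<in>\<N>. X = F + G + n"
    then show "\<exists>n\<in>\<N>. X = F + n" using Inn_add[OF assms] by (metis add.assoc)
  next
    assume "\<exists>n\<in>\<N>. X = F + n"
    then obtain n where "n \<in> \<N>" "X = F + G + (- G + n)" by (auto simp: add.assoc)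
    then show "\<exists>n\<in>\<N>. X = F + G + n" using Inn_add[OF Inn_minus[OF assms]] by blast
  qed
  then show "X \<in> (F + G) +o \<N> \<longleftrightarrow> X \<in> F +o \<N>" by (simp add: elt_set_plus_def)
qed

lemma cosets_AID:
  "(\<lambda>E. E +o \<N>) ` AID AS BR M =
    {pointwise_sum ({1..l} \<times> (- {0})) (\<lambda>(i, j). map_scale AS (a i j) (D_map scale bracket L l h i j)) +o \<N>
      | a. True}" (is "?A = ?B")
proof
  show "?A \<subseteq> ?B"
  proof
    fix X assume "X \<in> ?A"
    then obtain E where E: "E \<in> AID AS BR M" "X = E +o \<N>" by blast
    then obtain c y where "y \<in> M" "\<forall>i\<in>I. c 0 i = 0" "E = cent c + inner y"
      using AID_decomp by blast
    then have "X = cent c +o \<N>" using E(2) coset_absorb[of "inner y"] by (simp add: Inn_eq)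
    moreover obtain a where "cent c = pointwise_sum ({1..l} \<times> (- {0}))
        (\<lambda>(i, j). map_scale AS (a i j) (D_map scale bracket L l h i j))"
      by (rule exE[OF cent_eq_pointwise_sum[where c = c]])
        (use \<open>\<forall>i\<in>I. c 0 i = 0\<close> in blast)+
    ultimately show "X \<in> ?B" by (intro CollectI exI[of _ a]) simp
  qed
  show "?B \<subseteq> ?A"
    unfolding pointwise_sum_D by (auto intro!: imageI cent_AID)
qed

lemma sum_mem_set_sum:
  "finite J \<Longrightarrow> (\<And>i. i \<in> J \<Longrightarrow> f i \<in> X i) \<Longrightarrow> (\<Sum>i\<in>J. f i) \<in> (\<Sum>i\<in>J. X i)"
  by (induction J rule: finite_induct) (auto intro: set_plus_intro)

text \<open>The combination \<open>F\<close> of the representatives lies in the sum of the scaled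
  cosets, hence is inner. Its values are central, so \<open>F = 0\<close> by
  \<open>central_Inn_zero\<close>, and evaluation at \<open>loop (h i) j\<close> isolates the
  coefficient of \<open>(i, j)\<close>. This works in degree 0 as well.\<close>

lemma D_independent:
  "coset_independent (map_scale AS) \<N> ({1..l} \<times> UNIV) (\<lambda>(i, j). D_map scale bracket L l h i j +o \<N>)"
  unfolding coset_independent_def
proof (intro allI impI)
  fix J :: "(nat \<times> int) set" and c
  let ?D = "\<lambda>(i, j). D_map scale bracket L l h i j"
  assume J: "finite J \<and> J \<subseteq> {1..l} \<times> UNIV \<and>
    (\<Sum>ij\<in>J. coset_scale (map_scale AS) \<N> (c ij) (case ij of (i, j) \<Rightarrow> D_map scale bracket L l h i j +o \<N>)) = \<N>"
  define F where "F = (\<Sum>ij\<in>J. map_scale AS (c ij) (?D ij))"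
  have "map_scale AS (c ij) (?D ij) \<in>
      coset_scale (map_scale AS) \<N> (c ij) (case ij of (i, j) \<Rightarrow> D_map scale bracket L l h i j +o \<N>)" for ij
  proof -
    have "?D ij \<in> (case ij of (i, j) \<Rightarrow> D_map scale bracket L l h i j +o \<N>)"
      using Inn_zero set_zero_plus2 by (auto simp: elt_set_plus_def split: prod.splits intro!: bexI[of _ 0])
    then have "map_scale AS (c ij) (?D ij) + 0 \<in>
        coset_scale (map_scale AS) \<N> (c ij) (case ij of (i, j) \<Rightarrow> D_map scale bracket L l h i j +o \<N>)"
      unfolding coset_scale_def by (intro set_plus_intro imageI Inn_zero)
    then show ?thesis by simp
  qed
  then have "F \<in> (\<Sum>ij\<in>J. coset_scale (map_scale AS) \<N> (c ij)
      (case ij of (i, j) \<Rightarrow> D_map scale bracket L l h i j +o \<N>))"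
    unfolding F_def using J by (intro sum_mem_set_sum) auto
  then have "F \<in> \<N>" using J by simp
  have F_apply: "F u = (\<Sum>ij\<in>J. map_scale AS (c ij) (?D ij) u)" for u
    unfolding F_def by (induction J rule: infinite_finite_induct) (auto simp: plus_fun_apply)
  have "F = 0"
  proof (rule central_Inn_zero[OF \<open>F \<in> \<N>\<close>])
    fix u n
    have "map_scale AS (c ij) (?D ij) u =
        AS (c ij * snd (?D ij u)) central_K" if "ij \<in> J" for ij
      using that J by (cases ij) (auto simp: map_scale_def D_map_eq intro!: affine_eqI)
    then show "cf (F u) n = 0" by (simp add: F_apply AS_sum)
  qed
  show "\<forall>ij\<in>J. c ij = 0"
  proof
    fix ij assume ij: "ij \<in> J"
    obtain i j where ij_eq: "ij = (i, j)" and i: "i \<in> {1..l}" using J ij by auto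
    have "map_scale AS (c mn) (?D mn) (loop (h i) j) = (if mn = ij then AS (c ij) central_K else 0)"
      if "mn \<in> J" for mn
      using that J i by (cases mn) (auto simp: map_scale_def D_map_eq cent_dcoef_h ij_eq)
    then have "F (loop (h i) j) = AS (c ij) central_K"
      using ij J by (simp add: F_apply sum.delta)
    then show "c ij = 0" using \<open>F = 0\<close> by (metis snd_AS snd_central_K mult.right_neutral snd_zero zero_fun_apply)
  qed
qed

text \<open>The index \<open>i = 1\<close> suffices: if two of the maps differ by an inner
  derivation, that derivation has central values and is 0, yet \<open>loop (h 1) j\<close> tells the
  maps apart.\<close>

lemma infinite_D:
  assumes "1 \<le> l"
  shows "infinite {D_map scale bracket L l h i j +o \<N> | i j. i \<in> {1..l} \<and> j \<noteq> 0}"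
proof -
  let ?D = "D_map scale bracket L l h 1"
  have 1: "1 \<in> {1..l}" using assms by simp
  have "inj_on (\<lambda>j. ?D j +o \<N>) (- {0})"
  proof (rule inj_onI, rule ccontr)
    fix j j' assume eq: "?D j +o \<N> = ?D j' +o \<N>" and "j \<noteq> j'"
    have "?D j \<in> ?D j +o \<N>" using Inn_zero by (auto simp: elt_set_plus_def intro!: bexI[of _ 0])
    then have "?D j \<in> ?D j' +o \<N>" unfolding eq .
    then obtain G where G: "G \<in> \<N>" "?D j = ?D j' + G" unfolding elt_set_plus_def by blast
    have "cf (G u) n = 0" for u n
    proof -
      have "cf (?D j u) n = cf (?D j' u) n + cf (G u) n" by (subst G(2)) (simp add: plus_fun_apply)
      then show ?thesis using 1 by (simp add: D_map_eq)
    qed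
    then have "?D j = ?D j'" using central_Inn_zero[OF G(1)] G(2) by simp
    then have "?D j (loop (h 1) j) = ?D j' (loop (h 1) j)" by simp
    then have "(central_K :: ('k, 'a) affine) = 0"
      using 1 \<open>j \<noteq> j'\<close> by (simp add: D_map_eq cent_dcoef_h)
    then show False by (metis snd_central_K snd_zero zero_neq_one)
  qed
  moreover have "infinite (- {0 :: int})" by (simp add: infinite_UNIV_int finite_compl)
  ultimately have "infinite ((\<lambda>j. ?D j +o \<N>) ` (- {0}))" using finite_imageD by blast
  then show ?thesis
    by (rule infinite_super[rotated]) (use 1 in blast)
qed

end

theorem mainTheorem5:
  fixes s :: "'k::{alg_closed_field, field_char_0} \<Rightarrow> 'a::ab_group_add \<Rightarrow> 'a"
    and br :: "'a \<Rightarrow> 'a \<Rightarrow> 'a"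
    and H L :: "'a set"
    and l :: nat
    and h :: "nat \<Rightarrow> 'a"
    and M :: "('k, 'a) affine set"
    and A N :: "(('k, 'a) affine \<Rightarrow> ('k, 'a) affine) set"
    and D :: "nat \<Rightarrow> int \<Rightarrow> ('k, 'a) affine \<Rightarrow> ('k, 'a) affine"
  assumes lie: "lie_algebra s br"
    and fin_dim: "finite_dimensional s"
    and semisimple: "semisimple s br"
    and torus: "maximal_torus s br H"
    and minimal: "minimal_Q_graded s br H L"
    and dim: "vector_space.dim s L = 2 * vector_space.dim s (lie_product s br L L)"
    and basis_inj: "inj_on h {1..l}"
    and basis_indep: "\<not> module.dependent s (h ` {1..l})"
    and basis_span: "module.span s (h ` {1..l}) = H"
  defines "M \<equiv> affinization L"
    and "A \<equiv> AID (aff_scale s) (aff_bracket s br) M"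
    and "N \<equiv> Inn (aff_bracket s br) M"
    and "D \<equiv> D_map s br L l h"
  shows
    \<comment> \<open>the defining conditions determine the maps, which are derivations, almost inner if \<open>j \<noteq> 0\<close>\<close>
    "(\<forall>i\<in>{1..l}. \<forall>j. (\<exists>!E. D_spec s br L l h i j E) \<and>
        D i j \<in> derivations (aff_scale s) (aff_bracket s br) M \<and>
        (j \<noteq> 0 \<longrightarrow> D i j \<in> A)) \<and>
     (\<forall>a :: nat \<Rightarrow> int \<Rightarrow> 'k.
        pointwise_finite ({1..l} \<times> UNIV) (\<lambda>(i, j). map_scale (aff_scale s) (a i j) (D i j)) \<and>
        pointwise_sum ({1..l} \<times> UNIV) (\<lambda>(i, j). map_scale (aff_scale s) (a i j) (D i j))
          \<in> endomorphisms (aff_scale s) M) \<and>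
     (\<lambda>E. E +o N) ` A =
       {pointwise_sum ({1..l} \<times> (- {0})) (\<lambda>(i, j). map_scale (aff_scale s) (a i j) (D i j)) +o N
        | a :: nat \<Rightarrow> int \<Rightarrow> 'k. True} \<and>
     coset_independent (map_scale (aff_scale s)) N ({1..l} \<times> UNIV) (\<lambda>(i, j). D i j +o N) \<and>
     (1 \<le> l \<longrightarrow> infinite {D i j +o N | i j. i \<in> {1..l} \<and> j \<noteq> 0})"
proof -
  interpret T: torus_algebra s br H
    using lie fin_dim semisimple torus
    by (simp add: torus_algebra_def torus_algebra_axioms_def fd_lie_algebra_def
        fd_lie_algebra_axioms_def maximal_torus_def)
  have Q: "Q_graded s br H L" using minimal by (simp add: minimal_Q_graded_def)
  obtain I :: "('a \<Rightarrow> 'k) set" and e x where split: "split_pairs s br I e x"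
    and H: "H = module.span s (e ` I)" and P: "lie_product s br L L = module.span s (x ` I)"
    and L: "L = module.span s (e ` I \<union> x ` I)"
    by (rule T.split_structure[OF Q dim])
  interpret B: split_pairs_basis s br I e x l h
    by (intro split_pairs_basis.intro split_pairs_basis_axioms.intro split)
      (use basis_inj basis_indep basis_span H P L in auto)
  have D: "D i j = B.cent (B.dcoef i j)" if "i \<in> {1..l}" for i j
    unfolding D_def L by (rule B.D_map_eq[OF that])
  have spec: "\<exists>!E. D_spec s br L l h i j E" if "i \<in> {1..l}" for i j
    unfolding L using B.D_spec_cent[OF that] B.D_spec_unique[OF that] by blast
  have deriv: "D i j \<in> derivations (aff_scale s) (aff_bracket s br) M" if "i \<in> {1..l}" for i j
    unfolding D[OF that] M_def L by (rule B.cent_derivation)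
  have aid: "D i j \<in> A" if "i \<in> {1..l}" "j \<noteq> 0" for i j
    unfolding D[OF that(1)] A_def M_def L by (rule B.cent_AID) (use that(2) in \<open>simp add: B.dcoef_def\<close>)
  have finite: "pointwise_finite ({1..l} \<times> UNIV) (\<lambda>(i, j). map_scale (aff_scale s) (a i j) (D i j))" for a
    unfolding D_def L by (rule B.pointwise_finite_D)
  have endo: "pointwise_sum ({1..l} \<times> UNIV) (\<lambda>(i, j). map_scale (aff_scale s) (a i j) (D i j))
      \<in> endomorphisms (aff_scale s) M" for a
    unfolding D_def M_def L B.pointwise_sum_D by (rule B.cent_endomorphism)
  note fold = L[symmetric] M_def[symmetric]
  show ?thesis
    by (intro conjI ballI allI impI spec deriv aid finite endo
        B.cosets_AID[unfolded fold, folded A_def N_def, folded D_def]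
        B.D_independent[unfolded fold, folded A_def N_def, folded D_def]
        B.infinite_D[unfolded fold, folded A_def N_def, folded D_def])
qed

end
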